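(* Fix $s<0$. There does not exist a $T>0$ such that the equation $$u_t+u_x+uu_x+\mathcal{H}u_{xt}=0$$ admits, for initial data $u(x,0)=\phi(x)$, a unique local solution defined on the interval $[-T,T]$ and such that the flow map (data-to-solution map) $$\phi\longmapsto u(t),\qquad t\in[-T,T],$$ is $C^2$ differentiable at zero from $H^s_{per}$ to $H^s_{per}$.
   Context: $H^s_{per}=H^s_{per}([-\pi,\pi])$ is the Sobolev space of $2\pi$-periodic distributions with norm $\|f\|_{H^s_{per}}^2=2\pi\sum_{n\in\mathbb{Z}}(1+|n|^2)^s|\widehat f(n)|^2$, where $\widehat f(n)=\frac1{2\pi}\int_{-\pi}^{\pi}f(x)e^{-inx}dx$. $\mathcal{H}$ is the Hilbert transform $\widehat{\mathcal{H}f}(n)=-i\,\mathrm{sgn}(n)\widehat f(n)$. Solutions with datum $\phi$ are understood through the Duhamel formula $$u(t)=S(t)\phi-\int_0^tS(t-\tau)\Lambda[u(\tau)u_x(\tau)]\,d\tau,$$ where $\widehat{S(t)\phi}(n)=e^{-\frac{in}{1+|n|}t}\widehat\phi(n)$ and $\widehat{\Lambda u}(n)=(1+|n|)^{-1}\widehat u(n)$. *)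

theory Defs
  imports "HOL-Analysis.Analysis"
begin

section \<open>Periodic distributions\<close>

text \<open>
  A \<open>2\<pi>\<close>-periodic distribution is a continuous linear functional on the space of smooth
  \<open>2\<pi>\<close>-periodic functions \<open>\<real> \<rightarrow> \<complex>\<close>.  An integrable periodic function \<open>f\<close> is the distribution
  \<open>g \<mapsto> \<integral> f g\<close> (over a period, no complex conjugation).  The functionals are made \<open>0\<close> outside the
  test functions, so that equality of functionals is equality of distributions.
\<close>

definition vderiv :: "(real \<Rightarrow> complex) \<Rightarrow> real \<Rightarrow> complex" where
  "vderiv g = (\<lambda>x. vector_derivative g (at x))"

definition test_fun :: "(real \<Rightarrow> complex) \<Rightarrow> bool" where
  "test_fun g \<longleftrightarrow>
     (\<forall>x. g (x + 2 * pi) = g x) \<and> (\<forall>j x. (vderiv ^^ j) g differentiable (at x))"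

definition is_pdist :: "((real \<Rightarrow> complex) \<Rightarrow> complex) \<Rightarrow> bool" where
  "is_pdist L \<longleftrightarrow>
     (\<forall>g h. test_fun g \<longrightarrow> test_fun h \<longrightarrow> L (\<lambda>x. g x + h x) = L g + L h) \<and>
     (\<forall>c g. test_fun g \<longrightarrow> L (\<lambda>x. c * g x) = c * L g) \<and>
     (\<exists>C m. \<forall>g M. test_fun g \<longrightarrow> (\<forall>j\<le>m. \<forall>x. cmod ((vderiv ^^ j) g x) \<le> M) \<longrightarrow>
        cmod (L g) \<le> C * M) \<and>
     (\<forall>g. \<not> test_fun g \<longrightarrow> L g = 0)"

typedef pdist = "{L. is_pdist L}"
  morphisms pairing Abs_pdist
proof
  show "(\<lambda>_. 0) \<in> {L. is_pdist L}"
    by (auto simp: is_pdist_def intro!: exI[of _ 0])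
qed

setup_lifting type_definition_pdist

lemma is_pdist_add:
  assumes "is_pdist L" "is_pdist L'"
  shows "is_pdist (\<lambda>g. L g + L' g)"
proof -
  obtain C m where C: "\<And>g M. test_fun g \<Longrightarrow> (\<forall>j\<le>m. \<forall>x. cmod ((vderiv ^^ j) g x) \<le> M) \<Longrightarrow>
      cmod (L g) \<le> C * M"
    using assms(1) unfolding is_pdist_def by metis
  obtain C' m' where C': "\<And>g M. test_fun g \<Longrightarrow> (\<forall>j\<le>m'. \<forall>x. cmod ((vderiv ^^ j) g x) \<le> M) \<Longrightarrow>
      cmod (L' g) \<le> C' * M"
    using assms(2) unfolding is_pdist_def by metis
  have "cmod (L g + L' g) \<le> (C + C') * M"
    if "test_fun g" "\<forall>j\<le>max m m'. \<forall>x. cmod ((vderiv ^^ j) g x) \<le> M" for g M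
  proof -
    have "cmod (L g) \<le> C * M" "cmod (L' g) \<le> C' * M"
      using that by (auto intro!: C C')
    then show ?thesis
      using norm_triangle_ineq[of "L g" "L' g"] by (simp add: algebra_simps)
  qed
  then have "\<exists>C m. \<forall>g M. test_fun g \<longrightarrow> (\<forall>j\<le>m. \<forall>x. cmod ((vderiv ^^ j) g x) \<le> M) \<longrightarrow>
        cmod (L g + L' g) \<le> C * M"
    by blast
  then show ?thesis
    using assms unfolding is_pdist_def by (auto simp: algebra_simps)
qed

lemma is_pdist_scaleR:
  assumes "is_pdist L"
  shows "is_pdist (\<lambda>g. a *\<^sub>R L g)"
proof -
  obtain C m where C: "\<And>g M. test_fun g \<Longrightarrow> (\<forall>j\<le>m. \<forall>x. cmod ((vderiv ^^ j) g x) \<le> M) \<Longrightarrow>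
      cmod (L g) \<le> C * M"
    using assms unfolding is_pdist_def by metis
  have "cmod (a *\<^sub>R L g) \<le> (\<bar>a\<bar> * C) * M"
    if "test_fun g" "\<forall>j\<le>m. \<forall>x. cmod ((vderiv ^^ j) g x) \<le> M" for g M
    using C[OF that] by (simp add: mult.assoc mult_left_mono)
  then have "\<exists>C m. \<forall>g M. test_fun g \<longrightarrow> (\<forall>j\<le>m. \<forall>x. cmod ((vderiv ^^ j) g x) \<le> M) \<longrightarrow>
        cmod (a *\<^sub>R L g) \<le> C * M"
    by blast
  then show ?thesis
    using assms unfolding is_pdist_def by (auto simp: algebra_simps)
qed

instantiation pdist :: real_vector
begin

lift_definition zero_pdist :: pdist is "\<lambda>_. 0"
  by (auto simp: is_pdist_def intro!: exI[of _ 0])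

lift_definition plus_pdist :: "pdist \<Rightarrow> pdist \<Rightarrow> pdist" is "\<lambda>L L' g. L g + L' g"
  by (rule is_pdist_add)

lift_definition scaleR_pdist :: "real \<Rightarrow> pdist \<Rightarrow> pdist" is "\<lambda>a L g. a *\<^sub>R L g"
  by (rule is_pdist_scaleR)

definition uminus_pdist :: "pdist \<Rightarrow> pdist" where
  "uminus_pdist f = (- 1) *\<^sub>R f"

definition minus_pdist :: "pdist \<Rightarrow> pdist \<Rightarrow> pdist" where
  "minus_pdist f g = f + (- 1) *\<^sub>R g"

instance
  by standard
    (unfold uminus_pdist_def minus_pdist_def, (transfer; simp add: algebra_simps fun_eq_iff)+)

end


section \<open>Periodic Sobolev spaces\<close>

definition fcoeff :: "pdist \<Rightarrow> int \<Rightarrow> complex" where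
  "fcoeff f n = pairing f (\<lambda>x. cis (- (of_int n * x))) / of_real (2 * pi)"

definition Hper :: "real \<Rightarrow> pdist set" where
  "Hper s = {f. (\<lambda>n::int. (1 + (of_int n)\<^sup>2) powr s * (cmod (fcoeff f n))\<^sup>2) summable_on UNIV}"

text \<open>Only meaningful for \<open>f \<in> Hper s\<close>, since \<open>infsum\<close> is \<open>0\<close> on divergent sums.\<close>

definition Hnorm :: "real \<Rightarrow> pdist \<Rightarrow> real" where
  "Hnorm s f =
     sqrt (2 * pi * (\<Sum>\<^sub>\<infinity>n::int. (1 + (of_int n)\<^sup>2) powr s * (cmod (fcoeff f n))\<^sup>2))"


section \<open>The Duhamel formula\<close>

text \<open>
  Applying \<open>(1 + \<H>\<partial>\<^sub>x)\<inverse> = \<Lambda>\<close> to \<open>u\<^sub>t + u\<^sub>x + u u\<^sub>x + \<H>u\<^sub>x\<^sub>t = 0\<close> gives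
  \<open>u\<^sub>t + \<Lambda>u\<^sub>x + \<Lambda>(u u\<^sub>x) = 0\<close>, because \<open>\<H>\<partial>\<^sub>x\<close> has symbol \<open>(-i sgn n)(i n) = \<bar>n\<bar>\<close>.  The two
  functions below are the symbols of \<open>S(t)\<close> and of \<open>\<Lambda>\<close>.
\<close>

definition S_symbol :: "real \<Rightarrow> int \<Rightarrow> complex" where
  "S_symbol t n = exp (- (\<i> * of_int n / (1 + of_int \<bar>n\<bar>)) * of_real t)"

definition Lambda_symbol :: "int \<Rightarrow> complex" where
  "Lambda_symbol n = 1 / (1 + of_int \<bar>n\<bar>)"

text \<open>
  The \<open>n\<close>-th Fourier coefficient of \<open>(P\<^sub>K f) (P\<^sub>K f)\<^sub>x\<close>, where \<open>P\<^sub>K\<close> is the projection onto the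
  frequencies \<open>\<bar>k\<bar> \<le> K\<close>.
\<close>

definition trunc_nonlin :: "nat \<Rightarrow> pdist \<Rightarrow> int \<Rightarrow> complex" where
  "trunc_nonlin K f n =
     (\<Sum>k | \<bar>k\<bar> \<le> int K \<and> \<bar>n - k\<bar> \<le> int K. fcoeff f (n - k) * (\<i> * of_int k * fcoeff f k))"

text \<open>
  \<open>duhamel_term u t w\<close> says that the distribution \<open>w\<close> is \<open>\<integral>\<^sub>0\<^sup>t S(t-\<tau>) \<Lambda>[u(\<tau>) u\<^sub>x(\<tau>)] d\<tau>\<close>.
  For \<open>s < 0\<close> an element of \<open>H\<^sup>s\<close> need not be square integrable and \<open>u u\<^sub>x\<close> has no a priori
  meaning; the integral is therefore taken as the limit, in the sense of periodic distributions
  (that is, of each Fourier coefficient), of the same integrals for \<open>P\<^sub>K u\<close>.  For bounded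
  curves in \<open>L\<^sup>2\<close>, where \<open>u u\<^sub>x = (u\<^sup>2)\<^sub>x / 2\<close> is a distribution, the limit is the plain integral (lemma
  \<open>duhamel_limit_L2\<close>).  For continuous \<open>u\<close> the integrands below are continuous in \<open>\<tau>\<close>, being finite sums;
  \<open>LBINT \<tau>=0..t\<close> is the oriented integral, so \<open>t < 0\<close> is included.
\<close>

definition duhamel_term :: "(real \<Rightarrow> pdist) \<Rightarrow> real \<Rightarrow> pdist \<Rightarrow> bool" where
  "duhamel_term u t w \<longleftrightarrow>
     (\<forall>n. (\<lambda>K. LBINT \<tau>=0..t. S_symbol (t - \<tau>) n * Lambda_symbol n * trunc_nonlin K (u \<tau>) n)
            \<longlonglongrightarrow> fcoeff w n)"

text \<open>
  \<open>u \<in> C([-T,T]; H\<^sup>s)\<close> solves the equation with datum \<open>\<phi>\<close>: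
  \<open>u(t) = S(t)\<phi> - \<integral>\<^sub>0\<^sup>t S(t-\<tau>) \<Lambda>[u(\<tau>) u\<^sub>x(\<tau>)] d\<tau>\<close>, where the equality of distributions is that of
  all Fourier coefficients.  Values of \<open>u\<close> outside \<open>[-T,T]\<close> are irrelevant.
\<close>

definition solution :: "real \<Rightarrow> real \<Rightarrow> pdist \<Rightarrow> (real \<Rightarrow> pdist) \<Rightarrow> bool" where
  "solution s T \<phi> u \<longleftrightarrow>
     (\<forall>t\<in>{-T..T}. u t \<in> Hper s) \<and>
     (\<forall>t\<in>{-T..T}. ((\<lambda>r. Hnorm s (u r - u t)) \<longlongrightarrow> 0) (at t within {-T..T})) \<and>
     (\<forall>t\<in>{-T..T}. \<exists>w. duhamel_term u t w \<and>
        (\<forall>n. fcoeff (u t) n = S_symbol t n * fcoeff \<phi> n - fcoeff w n))"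


subsection \<open>Consistency with the plain Duhamel integral\<close>

lemma interval_integral_limit:
  fixes f :: "nat \<Rightarrow> real \<Rightarrow> complex" and t :: real
  assumes cont: "\<And>K. continuous_on {-\<bar>t\<bar>..\<bar>t\<bar>} (f K)"
    and lim: "\<And>\<tau>. \<tau> \<in> {-\<bar>t\<bar>..\<bar>t\<bar>} \<Longrightarrow> (\<lambda>K. f K \<tau>) \<longlonglongrightarrow> g \<tau>"
    and bound: "\<And>K \<tau>. \<tau> \<in> {-\<bar>t\<bar>..\<bar>t\<bar>} \<Longrightarrow> cmod (f K \<tau>) \<le> C"
  shows "(\<lambda>K. LBINT \<tau>=0..t. f K \<tau>) \<longlonglongrightarrow> (LBINT \<tau>=0..t. g \<tau>)"
proof -
  have main: "(\<lambda>K. LBINT \<tau>:{a..b}. f K \<tau>) \<longlonglongrightarrow> (LBINT \<tau>:{a..b}. g \<tau>)"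
    if sub: "{a..b} \<subseteq> {-\<bar>t\<bar>..\<bar>t\<bar>}" for a b
    unfolding set_lebesgue_integral_def
  proof (rule integral_dominated_convergence)
    show meas: "(\<lambda>x. indicator {a..b} x *\<^sub>R f K x) \<in> borel_measurable lborel" for K
      using borel_measurable_continuous_on_indicator[OF _ continuous_on_subset[OF cont[of K] sub]]
      by simp
    have lim': "(\<lambda>K. indicator {a..b} x *\<^sub>R f K x) \<longlonglongrightarrow> indicator {a..b} x *\<^sub>R g x" for x
      using lim[of x] sub by (cases "x \<in> {a..b}") auto
    then show "AE x in lborel. (\<lambda>K. indicator {a..b} x *\<^sub>R f K x)
        \<longlonglongrightarrow> indicator {a..b} x *\<^sub>R g x"
      by simp
    show "(\<lambda>x. indicator {a..b} x *\<^sub>R g x) \<in> borel_measurable lborel"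
      using borel_measurable_LIMSEQ_metric[OF meas lim'] .
    show "integrable lborel (\<lambda>x. indicator {a..b} x * C)"
      by (intro integrable_mult_left) (simp add: integrable_indicator_iff emeasure_lborel_Icc_eq)
    show "AE x in lborel. norm (indicator {a..b} x *\<^sub>R f K x) \<le> indicator {a..b} x * C" for K
      using bound[of _ K] sub by (intro AE_I2) (auto simp: indicator_def)
  qed
  show ?thesis
  proof (cases "0 \<le> t")
    case True
    then show ?thesis
      using main[of 0 t] by (simp add: interval_integral_Icc zero_ereal_def)
  next
    case False
    then have "(LBINT \<tau>=0..t. h \<tau>) = - (LBINT \<tau>:{t..0}. h \<tau>)" for h :: "real \<Rightarrow> complex"
      using interval_integral_endpoints_reverse[of 0 "ereal t" h]
      by (simp add: interval_integral_Icc zero_ereal_def)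
    then show ?thesis
      using main[of t 0] False by (simp add: tendsto_minus)
  qed
qed

lemma trunc_nonlin_sym:
  "trunc_nonlin K f n =
     (\<Sum>k | \<bar>k\<bar> \<le> int K \<and> \<bar>n - k\<bar> \<le> int K. \<i> * of_int n / 2 * (fcoeff f (n - k) * fcoeff f k))"
proof -
  let ?A = "{k. \<bar>k\<bar> \<le> int K \<and> \<bar>n - k\<bar> \<le> int K}"
  have "trunc_nonlin K f n = (\<Sum>k\<in>?A. fcoeff f k * (\<i> * of_int (n - k) * fcoeff f (n - k)))"
    unfolding trunc_nonlin_def
    by (rule sum.reindex_bij_witness[of _ "\<lambda>k. n - k" "\<lambda>k. n - k"]) auto
  then have "2 * trunc_nonlin K f n =
      (\<Sum>k\<in>?A. fcoeff f k * (\<i> * of_int (n - k) * fcoeff f (n - k))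
             + fcoeff f (n - k) * (\<i> * of_int k * fcoeff f k))"
    unfolding sum.distrib by (simp add: trunc_nonlin_def)
  also have "\<dots> = 2 * (\<Sum>k\<in>?A. \<i> * of_int n / 2 * (fcoeff f (n - k) * fcoeff f k))"
    unfolding sum_distrib_left by (rule sum.cong) (auto simp: algebra_simps)
  finally show ?thesis by simp
qed

lemma duhamel_limit_L2:
  fixes u :: "real \<Rightarrow> pdist" and t :: real
  assumes cont: "\<And>k. continuous_on {-\<bar>t\<bar>..\<bar>t\<bar>} (\<lambda>\<tau>. fcoeff (u \<tau>) k)"
    and sum: "\<And>\<tau>. \<tau> \<in> {-\<bar>t\<bar>..\<bar>t\<bar>} \<Longrightarrow> (\<lambda>k. (cmod (fcoeff (u \<tau>) k))\<^sup>2) summable_on UNIV"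
    and bound: "\<And>\<tau>. \<tau> \<in> {-\<bar>t\<bar>..\<bar>t\<bar>} \<Longrightarrow> (\<Sum>\<^sub>\<infinity>k. (cmod (fcoeff (u \<tau>) k))\<^sup>2) \<le> B"
  shows "(\<lambda>K. LBINT \<tau>=0..t. S_symbol (t - \<tau>) n * Lambda_symbol n * trunc_nonlin K (u \<tau>) n)
     \<longlonglongrightarrow> (LBINT \<tau>=0..t. S_symbol (t - \<tau>) n * Lambda_symbol n *
           (\<i> * of_int n / 2 * (\<Sum>\<^sub>\<infinity>k. fcoeff (u \<tau>) (n - k) * fcoeff (u \<tau>) k)))"
proof -
  let ?I = "{-\<bar>t\<bar>..\<bar>t\<bar>}"
  define A where "A K = {k. \<bar>k\<bar> \<le> int K \<and> \<bar>n - k\<bar> \<le> int K}" for K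
  define c where "c = \<i> * of_int n / 2"
  define P where "P \<tau> k = fcoeff (u \<tau>) (n - k) * fcoeff (u \<tau>) k" for \<tau> k
  define Q where "Q \<tau> k = (cmod (fcoeff (u \<tau>) k))\<^sup>2" for \<tau> k
  have finA: "finite (A K)" for K
    by (rule finite_subset[of _ "{- int K..int K}"]) (auto simp: A_def)
  have limA: "filterlim A (finite_subsets_at_top UNIV) sequentially"
    unfolding filterlim_finite_subsets_at_top
  proof (intro allI impI)
    fix X :: "int set" assume X: "finite X \<and> X \<subseteq> UNIV"
    define m where "m = (\<Sum>k\<in>X. nat \<bar>k\<bar>) + nat \<bar>n\<bar>"
    have "X \<subseteq> A K" if "K \<ge> m" for K
    proof
      fix k assume "k \<in> X"
      then have "nat \<bar>k\<bar> \<le> (\<Sum>k\<in>X. nat \<bar>k\<bar>)"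
        using X by (intro member_le_sum) auto
      with that show "k \<in> A K" unfolding A_def m_def by auto
    qed
    then show "\<forall>\<^sub>F K in sequentially. finite (A K) \<and> X \<subseteq> A K \<and> A K \<subseteq> UNIV"
      using finA by (auto simp: eventually_sequentially)
  qed
  have trunc: "trunc_nonlin K (u \<tau>) n = c * (\<Sum>k\<in>A K. P \<tau> k)" for K \<tau>
    unfolding trunc_nonlin_sym A_def c_def P_def by (simp add: sum_distrib_left)
  have Psum: "(\<Sum>k\<in>X. cmod (P \<tau> k)) \<le> B" if \<tau>: "\<tau> \<in> ?I" and X: "finite X" for \<tau> X
  proof -
    have le: "(\<Sum>k\<in>Y. Q \<tau> k) \<le> B" if "finite Y" for Y
    proof -
      have "(\<Sum>k\<in>Y. Q \<tau> k) \<le> (\<Sum>\<^sub>\<infinity>k. Q \<tau> k)"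
        using sum[OF \<tau>] that by (intro finite_sum_le_infsum) (auto simp: Q_def)
      then show ?thesis using bound[OF \<tau>] by (simp add: Q_def)
    qed
    have "(\<Sum>k\<in>X. cmod (P \<tau> k)) \<le> (\<Sum>k\<in>X. (Q \<tau> (n - k) + Q \<tau> k) / 2)"
    proof (rule sum_mono)
      fix k
      show "cmod (P \<tau> k) \<le> (Q \<tau> (n - k) + Q \<tau> k) / 2"
        using sum_squares_bound[of "cmod (fcoeff (u \<tau>) (n - k))" "cmod (fcoeff (u \<tau>) k)"]
        by (simp add: P_def Q_def norm_mult)
    qed
    also have "\<dots> = ((\<Sum>k\<in>X. Q \<tau> (n - k)) + (\<Sum>k\<in>X. Q \<tau> k)) / 2"
      by (simp add: sum.distrib sum_divide_distrib add_divide_distrib)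
    also have "(\<Sum>k\<in>X. Q \<tau> (n - k)) = (\<Sum>k\<in>(\<lambda>k. n - k) ` X. Q \<tau> k)"
      by (subst sum.reindex) (auto simp: inj_on_def)
    also have "((\<Sum>k\<in>(\<lambda>k. n - k) ` X. Q \<tau> k) + (\<Sum>k\<in>X. Q \<tau> k)) / 2 \<le> B"
      using le[OF X] le[of "(\<lambda>k. n - k) ` X"] X by simp
    finally show ?thesis .
  qed
  have lim: "(\<lambda>K. trunc_nonlin K (u \<tau>) n) \<longlonglongrightarrow> c * (\<Sum>\<^sub>\<infinity>k. P \<tau> k)" if \<tau>: "\<tau> \<in> ?I" for \<tau>
  proof -
    have "(\<lambda>k. norm (P \<tau> k)) summable_on UNIV"
      using Psum[OF \<tau>] by (intro nonneg_bdd_above_summable_on) (auto intro!: bdd_aboveI[of _ B])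
    then have "P \<tau> summable_on UNIV"
      by (rule abs_summable_summable)
    then have "(sum (P \<tau>) \<longlongrightarrow> (\<Sum>\<^sub>\<infinity>k. P \<tau> k)) (finite_subsets_at_top UNIV)"
      using has_sum_infsum unfolding has_sum_def by blast
    from filterlim_compose[OF this limA] show ?thesis
      unfolding trunc by (intro tendsto_mult_left)
  qed
  have S1: "cmod (S_symbol r n) = 1" for r
    unfolding S_symbol_def
    by (simp add: norm_exp_eq_Re Re_divide)
  show ?thesis
    unfolding c_def[symmetric] P_def[symmetric]
  proof (rule interval_integral_limit)
    show "continuous_on ?I (\<lambda>\<tau>. S_symbol (t - \<tau>) n * Lambda_symbol n * trunc_nonlin K (u \<tau>) n)"
      for K
      unfolding trunc_nonlin_def S_symbol_def by (intro continuous_intros cont)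
    show "(\<lambda>K. S_symbol (t - \<tau>) n * Lambda_symbol n * trunc_nonlin K (u \<tau>) n)
        \<longlonglongrightarrow> S_symbol (t - \<tau>) n * Lambda_symbol n * (c * (\<Sum>\<^sub>\<infinity>k. P \<tau> k))" if "\<tau> \<in> ?I" for \<tau>
      using lim[OF that] by (intro tendsto_mult_left)
    show "cmod (S_symbol (t - \<tau>) n * Lambda_symbol n * trunc_nonlin K (u \<tau>) n)
        \<le> cmod (Lambda_symbol n) * (cmod c * B)" if "\<tau> \<in> ?I" for K \<tau>
    proof -
      have "cmod (\<Sum>k\<in>A K. P \<tau> k) \<le> B"
        using norm_sum[of "P \<tau>" "A K"] Psum[OF that finA, of K] by linarith
      then show ?thesis
        unfolding trunc norm_mult S1 by (simp add: mult_left_mono)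
    qed
  qed
qed


section \<open>Differentiability\<close>

text \<open>
  Frechet differentiability of maps \<open>X \<rightarrow> X\<close>, where \<open>X\<close> is a subspace of a real vector space,
  normed by \<open>N\<close>.  (The space \<open>H\<^sup>s\<close> depends on the real number \<open>s\<close> and hence is not a type.)
  For \<open>X = UNIV\<close>, \<open>N = norm\<close> these are the library notions, see the lemmas below.  Linearity is
  over the reals.
\<close>

definition bdd_linear_on :: "'a::real_vector set \<Rightarrow> ('a \<Rightarrow> real) \<Rightarrow> ('a \<Rightarrow> 'a) \<Rightarrow> bool" where
  "bdd_linear_on X N A \<longleftrightarrow>
     (\<forall>h\<in>X. A h \<in> X) \<and>
     (\<forall>h\<in>X. \<forall>k\<in>X. A (h + k) = A h + A k) \<and>
     (\<forall>c. \<forall>h\<in>X. A (c *\<^sub>R h) = c *\<^sub>R A h) \<and>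
     (\<exists>C. \<forall>h\<in>X. N (A h) \<le> C * N h)"

definition frechet_deriv_on ::
    "'a::real_vector set \<Rightarrow> ('a \<Rightarrow> real) \<Rightarrow> ('a \<Rightarrow> 'a) \<Rightarrow> ('a \<Rightarrow> 'a) \<Rightarrow> 'a \<Rightarrow> bool" where
  "frechet_deriv_on X N f A x \<longleftrightarrow>
     bdd_linear_on X N A \<and>
     (\<forall>e>0. \<exists>d>0. \<forall>h\<in>X. N h < d \<longrightarrow>
        f (x + h) \<in> X \<and> N (f (x + h) - f x - A h) \<le> e * N h)"

text \<open>
  \<open>G\<close> is operator valued, its derivative \<open>B\<close> at \<open>x\<close> is a bounded bilinear map, and the remainder
  is estimated in operator norm.
\<close>

definition frechet_deriv_op_on ::
    "'a::real_vector set \<Rightarrow> ('a \<Rightarrow> real) \<Rightarrow> ('a \<Rightarrow> 'a \<Rightarrow> 'a) \<Rightarrow> ('a \<Rightarrow> 'a \<Rightarrow> 'a) \<Rightarrow> 'a \<Rightarrow> bool" where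
  "frechet_deriv_op_on X N G B x \<longleftrightarrow>
     (\<forall>h\<in>X. bdd_linear_on X N (\<lambda>k. B h k)) \<and>
     (\<forall>k\<in>X. bdd_linear_on X N (\<lambda>h. B h k)) \<and>
     (\<exists>C. \<forall>h\<in>X. \<forall>k\<in>X. N (B h k) \<le> C * N h * N k) \<and>
     (\<forall>e>0. \<exists>d>0. \<forall>h\<in>X. N h < d \<longrightarrow>
        (\<forall>k\<in>X. N (G (x + h) k - G x k - B h k) \<le> e * N h * N k))"

text \<open>
  \<open>C\<^sup>2\<close> at \<open>0\<close>: the first and second derivatives exist near \<open>0\<close> and the second derivative is
  continuous at \<open>0\<close>, in the norm of bounded bilinear maps.
\<close>

definition C2_at_zero :: "'a::real_vector set \<Rightarrow> ('a \<Rightarrow> real) \<Rightarrow> ('a \<Rightarrow> 'a) \<Rightarrow> bool" where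
  "C2_at_zero X N f \<longleftrightarrow>
     (\<exists>r>0. \<exists>D1 D2.
        (\<forall>x\<in>X. N x < r \<longrightarrow>
           frechet_deriv_on X N f (D1 x) x \<and> frechet_deriv_op_on X N D1 (D2 x) x) \<and>
        (\<forall>e>0. \<exists>d>0. \<forall>x\<in>X. N x < d \<longrightarrow>
           (\<forall>h\<in>X. \<forall>k\<in>X. N (D2 x h k - D2 0 h k) \<le> e * N h * N k)))"

lemma bdd_linear_on_UNIV: "bdd_linear_on UNIV norm A \<longleftrightarrow> bounded_linear A"
  unfolding bdd_linear_on_def bounded_linear_def bounded_linear_axioms_def linear_iff
  by (auto simp: mult.commute)

lemma all_translate:
  fixes x :: "'a::ab_group_add"
  shows "(\<forall>h. P h (x + h)) \<longleftrightarrow> (\<forall>y. P (y - x) y)"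
proof safe
  fix y assume "\<forall>h. P h (x + h)"
  then have "P (y - x) (x + (y - x))" by blast
  then show "P (y - x) y" by simp
next
  fix h assume "\<forall>y. P (y - x) y"
  then have "P (x + h - x) (x + h)" by blast
  then show "P h (x + h)" by simp
qed

lemma frechet_deriv_on_UNIV:
  fixes f :: "'a::real_normed_vector \<Rightarrow> 'a"
  shows "frechet_deriv_on UNIV norm f A x \<longleftrightarrow> (f has_derivative A) (at x)"
proof -
  have "(\<exists>d>0. \<forall>h. norm h < d \<longrightarrow> norm (f (x + h) - f x - A h) \<le> e * norm h) \<longleftrightarrow>
        (\<exists>d>0. \<forall>y. norm (y - x) < d \<longrightarrow> norm (f y - f x - A (y - x)) \<le> e * norm (y - x))" for e
    using all_translate[of "\<lambda>h y. norm h < _ \<longrightarrow> norm (f y - f x - A h) \<le> e * norm h" x] by simp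
  then show ?thesis
    unfolding frechet_deriv_on_def has_derivative_at_alt bdd_linear_on_UNIV by simp
qed

lemma frechet_deriv_op_on_UNIV:
  fixes G :: "'a::real_normed_vector \<Rightarrow> 'a \<Rightarrow>\<^sub>L 'a" and B :: "'a \<Rightarrow> 'a \<Rightarrow>\<^sub>L 'a"
  shows "frechet_deriv_op_on UNIV norm (\<lambda>x. blinfun_apply (G x)) (\<lambda>h. blinfun_apply (B h)) x
           \<longleftrightarrow> (G has_derivative B) (at x)"
proof -
  have op: "(\<forall>k. norm (blinfun_apply A k) \<le> c * norm k) \<longleftrightarrow> norm A \<le> c" if "0 \<le> c"
    for A :: "'a \<Rightarrow>\<^sub>L 'a" and c
    using that norm_blinfun_bound[of c A]
    by (auto intro: order_trans[OF norm_blinfun mult_right_mono])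
  have bl: "(\<forall>k. bounded_linear (\<lambda>h. blinfun_apply (B h) k)) \<and>
      (\<exists>C. \<forall>h k. norm (blinfun_apply (B h) k) \<le> C * norm h * norm k) \<longleftrightarrow> bounded_linear B"
    (is "?L \<longleftrightarrow> _")
  proof
    assume ?L
    then obtain C where lin: "\<And>k. bounded_linear (\<lambda>h. blinfun_apply (B h) k)"
      and C: "\<And>h k. norm (blinfun_apply (B h) k) \<le> C * norm h * norm k" by blast
    show "bounded_linear B"
    proof (rule bounded_linear_intro)
      show "B (h + h') = B h + B h'" for h h'
        by (rule blinfun_eqI)
          (simp add: blinfun.add_left linear_add[OF bounded_linear.linear[OF lin]])
      show "B (r *\<^sub>R h) = r *\<^sub>R B h" for r h
        by (rule blinfun_eqI)
          (simp add: blinfun.scaleR_left linear_scale[OF bounded_linear.linear[OF lin]])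
      show "norm (B h) \<le> norm h * \<bar>C\<bar>" for h
      proof (rule norm_blinfun_bound)
        show "norm (blinfun_apply (B h) k) \<le> norm h * \<bar>C\<bar> * norm k" for k
        proof -
          have "C * norm h * norm k \<le> \<bar>C\<bar> * norm h * norm k"
            by (intro mult_right_mono) auto
          then show ?thesis using C[of h k] by (simp add: mult_ac)
        qed
      qed simp
    qed
  next
    assume B: "bounded_linear B"
    then obtain C where C: "\<And>h. norm (B h) \<le> C * norm h"
      by (metis bounded_linear.bounded mult.commute)
    have "norm (blinfun_apply (B h) k) \<le> C * norm h * norm k" for h k
      by (rule order_trans[OF norm_blinfun mult_right_mono[OF C]]) simp
    moreover have "bounded_linear (\<lambda>h. blinfun_apply (B h) k)" for k
      by (rule bounded_linear_compose[OF blinfun.bounded_linear_left B])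
    ultimately show ?L by blast
  qed
  have "(\<exists>d>0. \<forall>h. norm h < d \<longrightarrow> norm (G (x + h) - G x - B h) \<le> e * norm h) \<longleftrightarrow>
        (\<exists>d>0. \<forall>y. norm (y - x) < d \<longrightarrow> norm (G y - G x - B (y - x)) \<le> e * norm (y - x))" for e
    using all_translate[of "\<lambda>h y. norm h < _ \<longrightarrow> norm (G y - G x - B h) \<le> e * norm h" x] by simp
  moreover have "(\<forall>k. norm (blinfun_apply (G (x + h)) k - blinfun_apply (G x) k - blinfun_apply (B h) k)
        \<le> e * norm h * norm k) \<longleftrightarrow> norm (G (x + h) - G x - B h) \<le> e * norm h" if "e > 0" for e h
    using op[of "e * norm h" "G (x + h) - G x - B h"] that by (simp add: blinfun.diff_left)
  ultimately show ?thesis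
    unfolding frechet_deriv_op_on_def has_derivative_at_alt bdd_linear_on_UNIV
    using bl by (auto simp: blinfun.bounded_linear_right)
qed

end

theory Submission
  imports Defs "HOL-Real_Asymp.Real_Asymp"
begin

text \<open>
  Distributions are complex valued, so \<open>\<phi> = \<gamma> e\<^sub>N\<close> with \<open>e\<^sub>N(x) = e\<^bsup>iNx\<^esup>\<close> is an admissible datum.
  For data with positive frequencies only, the Duhamel formula is triangular: the coefficient at
  \<open>n\<close> involves only those at \<open>1, \<dots>, n - 1\<close>.  It can be solved recursively, and for small data the
  solution decays geometrically in \<open>n\<close>, uniformly on \<open>[-T,T]\<close>; by uniqueness it is the flow.
  Its coefficient at \<open>2N\<close> is exactly \<open>\<gamma>\<^sup>2 c\<^sub>N(t)\<close>, so that \<open>2 c\<^sub>N(t)\<close> is the coefficient of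
  \<open>D\<^sup>2(0)(e\<^sub>N, e\<^sub>N)\<close>, and boundedness of the second derivative gives
  \<open>\<bar>c\<^sub>N(t)\<bar> \<le> C (1 + 4N\<^sup>2)\<^bsup>-s/2\<^esup> (1 + N\<^sup>2)\<^sup>s\<close>, which tends to \<open>0\<close>.  But
  \<open>\<bar>c\<^sub>N(t)\<bar>\<close> tends to \<open>\<bar>e\<^bsup>-it\<^esup> - 1\<bar> / 2 > 0\<close> for \<open>0 < t \<le> 1\<close>.
\<close>

section \<open>The unitary group and bounds for oriented integrals\<close>

lemma norm_S_symbol [simp]: "cmod (S_symbol t n) = 1"
  unfolding S_symbol_def by (simp add: norm_exp_eq_Re Re_divide)

lemma S_symbol_diff: "S_symbol (t - \<tau>) n = S_symbol t n * S_symbol (- \<tau>) n"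
proof -
  have "- c * complex_of_real (t - \<tau>) = - c * of_real t + - c * of_real (- \<tau>)" for c
    by (simp add: algebra_simps)
  then show ?thesis
    unfolding S_symbol_def by (simp only: exp_add)
qed

lemma S_symbol_0 [simp]: "S_symbol 0 n = 1"
  by (simp add: S_symbol_def)

lemma continuous_on_S_symbol [continuous_intros]:
  "continuous_on A g \<Longrightarrow> continuous_on A (\<lambda>t. S_symbol (g t) n)"
  unfolding S_symbol_def by (intro continuous_intros)

text \<open>The fundamental theorem is applied on a compact interval that contains \<open>0\<close>
  and has \<open>t\<close> in its interior; there the derivative within the interval is the full
  derivative.\<close>

lemma interval_integral_has_vector_derivative:
  fixes f :: "real \<Rightarrow> 'a::euclidean_space"
  assumes "continuous_on UNIV f"
  shows "((\<lambda>t. LBINT \<tau>=0..t. f \<tau>) has_vector_derivative f t) (at t)"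
proof -
  have "((\<lambda>t. LBINT \<tau>=ereal 0..t. f \<tau>) has_vector_derivative f t)
      (at t within {- \<bar>t\<bar> - 1..\<bar>t\<bar> + 1})"
    using assms by (intro interval_integral_FTC2) (auto intro: continuous_on_subset)
  moreover have "at t within {- \<bar>t\<bar> - 1..\<bar>t\<bar> + 1} = at t"
    by (rule at_within_interior) auto
  ultimately show ?thesis by (simp add: zero_ereal_def)
qed

text \<open>Mean value inequality: the integral, as a function of its upper limit, is compared with
  \<open>P\<close> through their derivatives. A bound by a primitive rather than by a length is what
  lets the induction for the majorant below close.\<close>

lemma norm_interval_integral_le_primitive:
  fixes f :: "real \<Rightarrow> 'a::euclidean_space" and P p :: "real \<Rightarrow> real"
  assumes f: "continuous_on UNIV f"
    and P: "\<And>x. (P has_real_derivative p x) (at x)"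
    and le: "\<And>\<tau>. norm (f \<tau>) \<le> p \<bar>\<tau>\<bar>"
  shows "norm (LBINT \<tau>=0..t. f \<tau>) \<le> P \<bar>t\<bar> - P 0"
proof -
  define F where "F t = (LBINT \<tau>=0..t. f \<tau>)" for t :: real
  have F0: "F 0 = 0"
    by (simp add: F_def zero_ereal_def)
  have F': "(F has_vector_derivative f x) (at x)" for x
    unfolding F_def by (rule interval_integral_has_vector_derivative[OF f])
  have "((\<lambda>x. - x) has_vector_derivative - 1) (at x)" for x :: real
    by (auto intro!: derivative_eq_intros)
  from vector_diff_chain_at[OF this F']
  have F'_neg: "((\<lambda>x. F (- x)) has_vector_derivative - f (- x)) (at x)" for x
    by (simp add: o_def)
  have P': "(P has_vector_derivative p x) (at x)" for x
    using P by (simp add: has_real_derivative_iff_has_vector_derivative)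
  \<comment> \<open>Stated for an arbitrary \<open>H\<close>, so that it serves both
    \<open>F\<close> for \<open>0 \<le> t\<close> and the reflection of \<open>F\<close> for
    negative \<open>t\<close>.\<close>
  have bound: "norm (H \<bar>t\<bar> - H 0) \<le> P \<bar>t\<bar> - P 0"
    if H': "\<And>x. (H has_vector_derivative h x) (at x)" and h: "\<And>x. norm (h x) \<le> p \<bar>x\<bar>"
    for H h :: "real \<Rightarrow> 'a"
  proof (cases "t = 0")
    case False
    show ?thesis
    proof (rule differentiable_bound_general[of 0 "\<bar>t\<bar>" H P h p])
      show "continuous_on {0..\<bar>t\<bar>} H" "continuous_on {0..\<bar>t\<bar>} P"
        by (auto intro!: continuous_at_imp_continuous_on has_vector_derivative_continuous H' P')
    qed (use False H' P' h[of x for x] in \<open>auto\<close>, metis abs_of_pos h)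
  qed simp
  show ?thesis
  proof (cases "0 \<le> t")
    case True
    then show ?thesis using bound[of F f] F' le F0 by (simp add: F_def)
  next
    case False
    then show ?thesis
      using bound[of "\<lambda>x. F (- x)" "\<lambda>x. - f (- x)"] F'_neg le[of "- x" for x] F0
      by (simp add: F_def)
  qed
qed

section \<open>The triangular Duhamel recursion\<close>

text \<open>The \<open>n\<close>-th Fourier coefficient of the solution whose datum has coefficients
  \<open>a\<close> at positive frequencies. A product feeds mode \<open>n\<close> only if both
  factors have frequency at least 1, so both \<open>k\<close> and \<open>n - k\<close> are below
  \<open>n\<close> and the recursion terminates.\<close>

function oneside :: "(nat \<Rightarrow> complex) \<Rightarrow> nat \<Rightarrow> real \<Rightarrow> complex" where
  "oneside a n t = S_symbol t (int n) * a n -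
     (LBINT \<tau>=0..t. S_symbol (t - \<tau>) (int n) * Lambda_symbol (int n) *
        (\<Sum>k\<in>{1..<n}. oneside a (n - k) \<tau> * (\<i> * of_nat k * oneside a k \<tau>)))"
  by auto
termination
  by (relation "Wellfounded.measure (\<lambda>(a, n, t). n)") auto

declare oneside.simps [simp del]

definition oneside_nonlin :: "(nat \<Rightarrow> complex) \<Rightarrow> nat \<Rightarrow> real \<Rightarrow> complex" where
  "oneside_nonlin a n \<tau> = (\<Sum>k\<in>{1..<n}. oneside a (n - k) \<tau> * (\<i> * of_nat k * oneside a k \<tau>))"

text \<open>Integrating factor form: the group property moves \<open>S_symbol t n\<close> out of the
  integral, so that \<open>t\<close> remains only in the upper limit. The outer factor has modulus 1
  and drops out of all estimates.\<close>

lemma oneside_factored: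
  "oneside a n t = S_symbol t n *
     (a n - (LBINT \<tau>=0..t. S_symbol (- \<tau>) n * (Lambda_symbol n * oneside_nonlin a n \<tau>)))"
proof -
  have "(LBINT \<tau>=0..t. S_symbol (t - \<tau>) n * Lambda_symbol n * oneside_nonlin a n \<tau>) =
      (LBINT \<tau>=0..t. S_symbol t n * (S_symbol (- \<tau>) n * (Lambda_symbol n * oneside_nonlin a n \<tau>)))"
    by (subst S_symbol_diff) (simp only: mult.assoc)
  then show ?thesis
    by (subst oneside.simps) (simp only: oneside_nonlin_def[symmetric] right_diff_distrib
        interval_lebesgue_integral_mult_right)
qed

lemma continuous_on_oneside: "continuous_on UNIV (oneside a n)"
proof (induction n rule: less_induct)
  case (less n)
  then have "continuous_on UNIV (oneside_nonlin a n)"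
    unfolding oneside_nonlin_def by (auto intro!: continuous_intros)
  then have "continuous_on UNIV (\<lambda>\<tau>. S_symbol (- \<tau>) n * (Lambda_symbol n * oneside_nonlin a n \<tau>))"
    by (intro continuous_intros)
  from interval_integral_has_vector_derivative[OF this]
  have "continuous_on UNIV (\<lambda>t::real. LBINT \<tau>=0..t.
      S_symbol (- \<tau>) n * (Lambda_symbol n * oneside_nonlin a n \<tau>))"
    by (auto intro!: continuous_at_imp_continuous_on has_vector_derivative_continuous)
  then have "continuous_on UNIV (\<lambda>t. S_symbol t n * (a n - (LBINT \<tau>=0..t.
      S_symbol (- \<tau>) n * (Lambda_symbol n * oneside_nonlin a n \<tau>))))"
    by (intro continuous_intros)
  then show ?case
    by (subst oneside_factored[abs_def])
qed

lemma continuous_on_oneside_nonlin: "continuous_on UNIV (oneside_nonlin a n)"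
  unfolding oneside_nonlin_def by (intro continuous_intros continuous_on_oneside)

text \<open>
  The majorant \<open>y\<^sub>n(t) = A (r + A t)\<^bsup>n - 1\<^esup>\<close> solves \<open>y\<^sub>n' = \<Sum>\<^sub>k y\<^sub>n\<^sub>-\<^sub>k y\<^sub>k\<close>, and the symbol \<open>k / (1 + n)\<close> of
  the nonlinear term is at most \<open>1\<close>.
\<close>

lemma norm_oneside_le:
  assumes a: "\<And>n. n \<ge> 1 \<Longrightarrow> cmod (a n) \<le> A * r ^ (n - 1)"
    and "0 \<le> A" "0 \<le> r" "n \<ge> 1"
  shows "cmod (oneside a n t) \<le> A * (r + A * \<bar>t\<bar>) ^ (n - 1)"
  using \<open>n \<ge> 1\<close>
proof (induction n arbitrary: t rule: less_induct)
  case (less n)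
  define q where "q x = r + A * x" for x
  define P where "P x = A * q x ^ (n - 1)" for x
  \<comment> \<open>The derivative of \<open>P\<close>. For \<open>n = 1\<close> the truncated
    exponent \<open>n - 2\<close> is harmless, because the factor \<open>real (n - 1)\<close> is
    0.\<close>
  define p where "p x = A * (real (n - 1) * q x ^ (n - 2) * A)" for x
  have q_nonneg: "0 \<le> q \<bar>x\<bar>" for x
    using assms by (simp add: q_def)
  have P': "(P has_real_derivative p x) (at x)" for x
    unfolding P_def p_def q_def
    by (auto intro!: derivative_eq_intros simp: numeral_2_eq_2)
  have "cmod (Lambda_symbol n * oneside_nonlin a n \<tau>) \<le> p \<bar>\<tau>\<bar>" for \<tau>
  proof -
    \<comment> \<open>The derivative costs \<open>k\<close>, estimated by \<open>1 + n\<close>,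
      which \<open>Lambda_symbol n\<close> cancels. The exponents add up to \<open>n - 2\<close>
      whatever \<open>k\<close> is, so all \<open>n - 1\<close> terms obey the same bound and
      together give exactly \<open>p\<close>.\<close>
    have "cmod (oneside a (n - k) \<tau> * (\<i> * of_nat k * oneside a k \<tau>)) \<le>
        (1 + real n) * (A\<^sup>2 * q \<bar>\<tau>\<bar> ^ (n - 2))" if k: "k \<in> {1..<n}" for k
    proof -
      have "cmod (oneside a (n - k) \<tau>) \<le> A * q \<bar>\<tau>\<bar> ^ (n - k - 1)"
        "cmod (oneside a k \<tau>) \<le> A * q \<bar>\<tau>\<bar> ^ (k - 1)"
        using less.IH[of "n - k" \<tau>] less.IH[of k \<tau>] k by (auto simp: q_def)
      then have "cmod (oneside a (n - k) \<tau>) * (real k * cmod (oneside a k \<tau>)) \<le>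
          (A * q \<bar>\<tau>\<bar> ^ (n - k - 1)) * ((1 + real n) * (A * q \<bar>\<tau>\<bar> ^ (k - 1)))"
        using k q_nonneg[of \<tau>] \<open>0 \<le> A\<close> by (intro mult_mono) auto
      also have "\<dots> = (1 + real n) * (A\<^sup>2 * q \<bar>\<tau>\<bar> ^ ((n - k - 1) + (k - 1)))"
        by (simp add: power_add power2_eq_square)
      also have "(n - k - 1) + (k - 1) = n - 2"
        using k by auto
      finally show ?thesis by (simp add: norm_mult)
    qed
    then have "cmod (oneside_nonlin a n \<tau>) \<le> real (n - 1) * ((1 + real n) * (A\<^sup>2 * q \<bar>\<tau>\<bar> ^ (n - 2)))"
      unfolding oneside_nonlin_def by (intro order_trans[OF sum_norm_bound]) auto
    then have "cmod (oneside_nonlin a n \<tau>) / (1 + real n) \<le> p \<bar>\<tau>\<bar>"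
      by (simp add: p_def power2_eq_square divide_le_eq mult_ac)
    moreover have "Lambda_symbol n = of_real (1 / (1 + real n))"
      by (simp add: Lambda_symbol_def)
    ultimately show ?thesis
      by (simp add: norm_mult del: of_real_divide of_real_add)
  qed
  then have "cmod (LBINT \<tau>=0..t. S_symbol (- \<tau>) n * (Lambda_symbol n * oneside_nonlin a n \<tau>))
      \<le> P \<bar>t\<bar> - P 0"
    by (intro norm_interval_integral_le_primitive[OF _ P'] continuous_intros
        continuous_on_oneside_nonlin) (simp add: norm_mult)
  moreover have "cmod (a n) \<le> P 0"
    using a[OF less.prems] by (simp add: P_def q_def)
  ultimately have "cmod (oneside a n t) \<le> P \<bar>t\<bar>"
    by (subst oneside_factored, subst norm_mult) (simp add: order_trans[OF norm_triangle_ineq4])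
  then show ?case by (simp add: P_def q_def)
qed

text \<open>If \<open>n < 2 * N\<close>, then in every product one of the frequencies
  \<open>k\<close> and \<open>n - k\<close> is below \<open>N\<close>, and that factor vanishes by
  induction. The first mode that \<open>N\<close> can excite is \<open>2 * N\<close>.\<close>

lemma oneside_eq_0:
  assumes a: "\<And>k. k \<noteq> N \<Longrightarrow> a k = 0" and "n < 2 * N" "n \<noteq> N"
  shows "oneside a n t = 0"
  using assms(2,3)
proof (induction n arbitrary: t rule: less_induct)
  case (less n)
  have "oneside a (n - k) \<tau> * (\<i> * of_nat k * oneside a k \<tau>) = 0" if "k \<in> {1..<n}" for k \<tau>
  proof (cases "k < N")
    case True
    then show ?thesis using less.IH[of k] less.prems that by auto
  next
    case False
    then show ?thesis using less.IH[of "n - k"] less.prems that by auto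
  qed
  then have "oneside_nonlin a n = (\<lambda>_. 0)"
    unfolding oneside_nonlin_def by (auto intro!: sum.neutral)
  then show ?case
    using a less.prems by (simp add: oneside_factored)
qed

text \<open>All modes below \<open>N\<close> vanish, so nothing feeds mode \<open>N\<close> and it
  evolves freely.\<close>

lemma oneside_base:
  assumes a: "\<And>k. k \<noteq> N \<Longrightarrow> a k = 0"
  shows "oneside a N t = S_symbol t N * a N"
proof -
  have "oneside a (N - k) \<tau> * (\<i> * of_nat k * oneside a k \<tau>) = 0" if "k \<in> {1..<N}" for k \<tau>
    using oneside_eq_0[OF a, where n=k] that by auto
  then have "oneside_nonlin a N = (\<lambda>_. 0)"
    unfolding oneside_nonlin_def by (auto intro!: sum.neutral)
  then show ?thesis
    by (simp add: oneside_factored)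
qed

text \<open>Only the interaction of mode \<open>N\<close> with itself survives, and that mode is
  known exactly. Hence the coefficient is exactly quadratic in \<open>a N\<close>, with no higher
  order correction.\<close>

lemma oneside_double:
  assumes a: "\<And>k. k \<noteq> N \<Longrightarrow> a k = 0" and "N \<ge> 1"
  shows "oneside a (2 * N) t = - (a N)\<^sup>2 * S_symbol t (int (2 * N)) *
     (LBINT \<tau>=0..t. S_symbol (- \<tau>) (int (2 * N)) * (Lambda_symbol (int (2 * N)) *
        (\<i> * of_nat N * (S_symbol \<tau> (int N))\<^sup>2)))"
proof -
  have nonlin: "oneside_nonlin a (2 * N) \<tau> = (a N)\<^sup>2 * (\<i> * of_nat N * (S_symbol \<tau> N)\<^sup>2)" for \<tau>
  proof -
    have "oneside_nonlin a (2 * N) \<tau> =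
        (\<Sum>k\<in>{N}. oneside a (2 * N - k) \<tau> * (\<i> * of_nat k * oneside a k \<tau>))"
      unfolding oneside_nonlin_def
    proof (rule sum.mono_neutral_right)
      show "\<forall>k\<in>{1..<2 * N} - {N}. oneside a (2 * N - k) \<tau> * (\<i> * of_nat k * oneside a k \<tau>) = 0"
        using oneside_eq_0[OF a] by auto
    qed (use \<open>N \<ge> 1\<close> in auto)
    then show ?thesis
      by (simp add: oneside_base[OF a] power2_eq_square)
  qed
  have "(LBINT \<tau>=0..t. S_symbol (- \<tau>) (int (2 * N)) *
        (Lambda_symbol (int (2 * N)) * oneside_nonlin a (2 * N) \<tau>)) =
      (LBINT \<tau>=0..t. (a N)\<^sup>2 * (S_symbol (- \<tau>) (int (2 * N)) *
        (Lambda_symbol (int (2 * N)) * (\<i> * of_nat N * (S_symbol \<tau> N)\<^sup>2))))"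
    unfolding nonlin by (simp only: mult_ac)
  also have "\<dots> = (a N)\<^sup>2 * (LBINT \<tau>=0..t. (S_symbol (- \<tau>) (int (2 * N)) *
        (Lambda_symbol (int (2 * N)) * (\<i> * of_nat N * (S_symbol \<tau> N)\<^sup>2))))"
    by (rule interval_lebesgue_integral_mult_right) 
  finally show ?thesis
    using a[of "2 * N"] \<open>N \<ge> 1\<close> by (subst oneside_factored) simp
qed

section \<open>Distributions with prescribed coefficients\<close>

lemma has_vector_derivative_cis:
  "((\<lambda>x. cis (c * x)) has_vector_derivative \<i> * of_real c * cis (c * x)) (at x within A)"
proof -
  have "((\<lambda>z. exp (\<i> * of_real c * z)) has_field_derivative
      \<i> * of_real c * exp (\<i> * of_real c * of_real x)) (at (of_real x))"
    by (auto intro!: derivative_eq_intros)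
  from has_vector_derivative_real_field[OF this] show ?thesis
    by (simp add: cis_conv_exp mult.assoc)
qed

lemma vderiv_eqI: "(\<And>x. (f has_vector_derivative f' x) (at x)) \<Longrightarrow> vderiv f = f'"
  by (auto simp: vderiv_def intro!: vector_derivative_at)

lemma has_vector_derivative_vderiv:
  "f differentiable (at x) \<Longrightarrow> (f has_vector_derivative vderiv f x) (at x)"
  by (simp add: vderiv_def vector_derivative_works)

lemma vderiv_iter_cis: "(vderiv ^^ j) (\<lambda>x. cis (c * x)) = (\<lambda>x. (\<i> * of_real c) ^ j * cis (c * x))"
proof (induction j)
  case (Suc j)
  have "((\<lambda>x. (\<i> * of_real c) ^ j * cis (c * x)) has_vector_derivative
      (\<i> * of_real c) ^ Suc j * cis (c * x)) (at x)" for x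
    using has_vector_derivative_mult_right[OF has_vector_derivative_cis,
        of "(\<i> * of_real c) ^ j" c x UNIV] by (simp add: mult_ac)
  then show ?case
    by (auto simp: Suc.IH intro!: vderiv_eqI)
qed simp

lemma test_fun_cis: "test_fun (\<lambda>x. cis (of_int n * x))"
proof -
  have "cis (of_int n * (x + 2 * pi)) = cis (of_int n * x)" for x
  proof -
    have "of_int n * (x + 2 * pi) = of_int n * x + 2 * pi * of_int n"
      by (simp add: algebra_simps)
    then show ?thesis
      by (simp only: cis_mult[symmetric] cis_multiple_2pi Ints_of_int mult_1_right)
  qed
  moreover have "(\<lambda>x. (\<i> * of_real c) ^ j * cis (c * x)) differentiable (at x)" for c j x
    by (rule differentiableI_vector has_vector_derivative_mult_right has_vector_derivative_cis)+
  ultimately show ?thesis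
    unfolding test_fun_def vderiv_iter_cis by blast
qed

lemma continuous_on_test_fun:
  assumes "test_fun g"
  shows "continuous_on A g"
proof -
  have "(vderiv ^^ 0) g differentiable (at x)" for x
    using assms unfolding test_fun_def by blast
  then show ?thesis
    by (auto intro!: continuous_at_imp_continuous_on differentiable_imp_continuous_within)
qed

text \<open>Orthogonality of the exponentials: for nonzero \<open>m\<close> a primitive takes equal
  values at both ends of the period.\<close>

lemma integral_cis:
  "integral {- pi..pi} (\<lambda>x. cis (of_int m * x)) = (if m = 0 then of_real (2 * pi) else 0)"
proof (cases "m = 0")
  case False
  have "((\<lambda>x. cis (of_int m * x)) has_integral
      cis (of_int m * pi) / (\<i> * of_int m) - cis (of_int m * (- pi)) / (\<i> * of_int m)) {- pi..pi}"
  proof (rule fundamental_theorem_of_calculus)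
    show "((\<lambda>x. cis (of_int m * x) / (\<i> * of_int m)) has_vector_derivative cis (of_int m * x))
        (at x within {- pi..pi})" for x
      using has_vector_derivative_divide[OF has_vector_derivative_cis[of "of_int m" x "{- pi..pi}"],
          of "\<i> * of_int m"] False by simp
  qed simp
  moreover have "cis (of_int m * pi) = cis (of_int m * (- pi))"
    by (simp add: complex_eq_iff sin_int_times_real sin_times_pi_eq_0)
  ultimately show ?thesis
    using False by (auto dest: integral_unique)
qed (simp add: scaleR_conv_of_real)

definition pairing_mode :: "nat \<Rightarrow> (real \<Rightarrow> complex) \<Rightarrow> complex" where
  "pairing_mode n g = integral {- pi..pi} (\<lambda>x. cis (of_int (int n) * x) * g x)"

lemma norm_pairing_mode_le:
  assumes "test_fun g" and M: "\<And>x. cmod (g x) \<le> M"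
  shows "cmod (pairing_mode n g) \<le> 2 * pi * M"
proof -
  have "cmod (pairing_mode n g) \<le> M * (pi - - pi)"
    unfolding pairing_mode_def
    by (rule integral_bound)
      (use assms in \<open>auto intro!: continuous_on_mult continuous_on_cis continuous_intros
        simp: norm_mult continuous_on_test_fun\<close>)
  then show ?thesis by (simp add: mult_ac)
qed

text \<open>Each mode pairs with a test function \<open>g\<close> to at most \<open>2 * pi\<close>
  times the supremum of \<open>g\<close>, so absolute summability of \<open>a\<close> makes the
  series converge and gives a distribution of order 0.\<close>

lemma is_pdist_pairing_mode:
  assumes a: "summable (\<lambda>n. cmod (a n))"
  shows "is_pdist (\<lambda>g. if test_fun g then \<Sum>n. a n * pairing_mode n g else 0)"
proof -
  \<comment> \<open>Compactness bounds \<open>g\<close> on one period, and a shift by a multiple of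
    the period reaches every point.\<close>
  have bdd: "\<exists>M. \<forall>x. cmod (g x) \<le> M" if g: "test_fun g" for g
  proof -
    have "bounded (g ` {0..2 * pi})"
      using g by (intro compact_imp_bounded compact_continuous_image continuous_on_test_fun) auto
    then obtain M where M: "\<And>x. x \<in> {0..2 * pi} \<Longrightarrow> cmod (g x) \<le> M"
      unfolding bounded_iff by blast
    have shift: "g (x + of_int k * (2 * pi)) = g x" for x k
    proof -
      interpret periodic_fun_simple g "2 * pi"
        using g by unfold_locales (simp add: test_fun_def)
      show ?thesis by (rule plus_of_int)
    qed
    have "cmod (g x) \<le> M" for x
    proof -
      define k where "k = \<lfloor>x / (2 * pi)\<rfloor>"
      have "of_int k \<le> x / (2 * pi)" "x / (2 * pi) < of_int k + 1"
        unfolding k_def by linarith+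
      then have "x - of_int k * (2 * pi) \<in> {0..2 * pi}"
        by (simp add: field_simps)
      then show ?thesis
        using M[of "x - of_int k * (2 * pi)"] shift[of "x - of_int k * (2 * pi)" k] by simp
    qed
    then show ?thesis by blast
  qed
  have norm_summable: "summable (\<lambda>n. cmod (a n * pairing_mode n g))" if g: "test_fun g" for g
  proof -
    obtain M where M: "\<And>x. cmod (g x) \<le> M" using bdd[OF g] by blast
    show ?thesis
    proof (rule summable_comparison_test')
      show "summable (\<lambda>n. cmod (a n) * (2 * pi * M))"
        by (intro summable_mult2 a)
      show "norm (cmod (a n * pairing_mode n g)) \<le> cmod (a n) * (2 * pi * M)" for n
        using norm_pairing_mode_le[OF g M] by (simp add: norm_mult mult_left_mono)
    qed
  qed
  note summable = summable_norm_cancel[OF norm_summable]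
  have int: "(\<lambda>x. cis (of_int (int n) * x) * g x) integrable_on {- pi..pi}" if "test_fun g" for n g
    using that by (intro integrable_continuous_interval)
      (intro continuous_intros continuous_on_test_fun)
  have test_add: "test_fun (\<lambda>x. g x + h x)" if g: "test_fun g" and h: "test_fun h" for g h
  proof -
    have iter: "(vderiv ^^ j) (\<lambda>x. g x + h x) = (\<lambda>x. (vderiv ^^ j) g x + (vderiv ^^ j) h x)" for j
    proof (induction j)
      case (Suc j)
      show ?case
        using g h by (auto simp: Suc.IH test_fun_def
            intro!: vderiv_eqI has_vector_derivative_add has_vector_derivative_vderiv)
    qed simp
    show ?thesis
      using g h unfolding test_fun_def iter by (auto intro!: derivative_intros)
  qed
  have test_mult: "test_fun (\<lambda>x. c * g x)" if g: "test_fun g" for c g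
  proof -
    have iter: "(vderiv ^^ j) (\<lambda>x. c * g x) = (\<lambda>x. c * (vderiv ^^ j) g x)" for j
    proof (induction j)
      case (Suc j)
      show ?case
        using g by (auto simp: Suc.IH test_fun_def
            intro!: vderiv_eqI has_vector_derivative_mult_right has_vector_derivative_vderiv)
    qed simp
    show ?thesis
      using g unfolding test_fun_def iter by (auto intro!: derivative_intros)
  qed
  have "pairing_mode n (\<lambda>x. g x + h x) = pairing_mode n g + pairing_mode n h"
    if "test_fun g" "test_fun h" for n g h
    unfolding pairing_mode_def using int that by (simp add: distrib_left integral_add)
  then have add: "(\<Sum>n. a n * pairing_mode n (\<lambda>x. g x + h x)) =
      (\<Sum>n. a n * pairing_mode n g) + (\<Sum>n. a n * pairing_mode n h)"
    if "test_fun g" "test_fun h" for g h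
    using that by (simp add: distrib_left suminf_add summable)
  have "pairing_mode n (\<lambda>x. c * g x) = c * pairing_mode n g" for n c g
    unfolding pairing_mode_def by (subst integral_mult_right[symmetric]) (simp only: mult_ac)
  then have mult: "(\<Sum>n. a n * pairing_mode n (\<lambda>x. c * g x)) = c * (\<Sum>n. a n * pairing_mode n g)"
    if "test_fun g" for c g
    using that by (subst suminf_mult[symmetric]) (auto simp: summable mult_ac)
  have "cmod (\<Sum>n. a n * pairing_mode n g) \<le> ((\<Sum>n. cmod (a n)) * (2 * pi)) * M"
    if g: "test_fun g" and M: "\<forall>j\<le>0. \<forall>x. cmod ((vderiv ^^ j) g x) \<le> M" for g M
  proof -
    have "cmod (\<Sum>n. a n * pairing_mode n g) \<le> (\<Sum>n. cmod (a n * pairing_mode n g))"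
      by (rule summable_norm[OF norm_summable[OF g]])
    also have "\<dots> \<le> (\<Sum>n. cmod (a n) * (2 * pi * M))"
      using norm_pairing_mode_le[OF g, of M] M
      by (intro suminf_le norm_summable[OF g] summable_mult2 a)
        (auto simp: norm_mult intro!: mult_left_mono)
    also have "\<dots> = ((\<Sum>n. cmod (a n)) * (2 * pi)) * M"
      by (subst suminf_mult2[symmetric, OF a]) simp
    finally show ?thesis .
  qed
  then have "\<exists>C m. \<forall>g M. test_fun g \<longrightarrow> (\<forall>j\<le>m. \<forall>x. cmod ((vderiv ^^ j) g x) \<le> M) \<longrightarrow>
      cmod (\<Sum>n. a n * pairing_mode n g) \<le> C * M"
    by blast
  then show ?thesis
    unfolding is_pdist_def using add mult test_add test_mult by simp
qed

text \<open>The Fourier series with coefficients \<open>a\<close> at nonnegative frequencies.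
  Absolute summability of \<open>a\<close> guarantees that the argument of \<open>Abs_pdist\<close>
  is a distribution.\<close>

definition pdist_of_coeffs :: "(nat \<Rightarrow> complex) \<Rightarrow> pdist" where
  "pdist_of_coeffs a = Abs_pdist (\<lambda>g. if test_fun g then \<Sum>n. a n * pairing_mode n g else 0)"

lemma fcoeff_pdist_of_coeffs:
  assumes "summable (\<lambda>n. cmod (a n))"
  shows "fcoeff (pdist_of_coeffs a) k = (if 0 \<le> k then a (nat k) else 0)"
proof -
  let ?e = "\<lambda>x. cis (- (of_int k * x))"
  have "test_fun ?e"
    using test_fun_cis[of "- k"] by simp
  moreover have "pairing_mode n ?e = (if int n = k then of_real (2 * pi) else 0)" for n
  proof -
    have "cis (of_int (int n) * x) * cis (- (of_int k * x)) = cis (of_int (int n - k) * x)" for x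
      by (simp add: cis_mult left_diff_distrib)
    then show ?thesis
      unfolding pairing_mode_def by (simp only: integral_cis right_minus_eq)
  qed
  ultimately have "pairing (pdist_of_coeffs a) ?e =
      (\<Sum>n. a n * (if int n = k then of_real (2 * pi) else 0))"
    unfolding pdist_of_coeffs_def
    by (subst Abs_pdist_inverse) (simp_all add: is_pdist_pairing_mode[OF assms])
  also have "\<dots> = (\<Sum>n\<in>{nat k}. a n * (if int n = k then of_real (2 * pi) else 0))"
  proof (rule suminf_finite)
    fix n assume "n \<notin> {nat k}"
    then have "int n \<noteq> k" by auto
    then show "a n * (if int n = k then of_real (2 * pi) else 0) = 0" by simp
  qed simp
  finally show ?thesis
    unfolding fcoeff_def by (cases "0 \<le> k") simp_all
qed

section \<open>Linear structure and norm of the periodic Sobolev spaces\<close>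

lemma fcoeff_add: "fcoeff (f + g) n = fcoeff f n + fcoeff g n"
  by (simp only: fcoeff_def plus_pdist.rep_eq add_divide_distrib)

lemma fcoeff_scaleR: "fcoeff (c *\<^sub>R f) n = c *\<^sub>R fcoeff f n"
  by (simp only: fcoeff_def scaleR_pdist.rep_eq scaleR_conv_of_real times_divide_eq_right)

lemma fcoeff_diff: "fcoeff (f - g) n = fcoeff f n - fcoeff g n"
  by (simp only: minus_pdist_def fcoeff_add fcoeff_scaleR) simp

lemma Hper_scaleR:
  assumes "f \<in> Hper s"
  shows "c *\<^sub>R f \<in> Hper s"
proof -
  have "(\<lambda>n. c\<^sup>2 * ((1 + (of_int n)\<^sup>2) powr s * (cmod (fcoeff f n))\<^sup>2)) summable_on UNIV"
    using assms by (intro summable_on_cmult_right) (simp add: Hper_def)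
  then show ?thesis
    by (simp add: Hper_def fcoeff_scaleR power_mult_distrib mult.left_commute)
qed

lemma Hper_add:
  assumes "f \<in> Hper s" "g \<in> Hper s"
  shows "f + g \<in> Hper s"
proof -
  let ?w = "\<lambda>n::int. (1 + (of_int n)\<^sup>2) powr s :: real"
  have "(\<lambda>n. 2 * (?w n * (cmod (fcoeff f n))\<^sup>2 + ?w n * (cmod (fcoeff g n))\<^sup>2)) summable_on UNIV"
    using assms by (intro summable_on_cmult_right summable_on_add) (simp_all add: Hper_def)
  then have "(\<lambda>n. ?w n * (cmod (fcoeff (f + g) n))\<^sup>2) summable_on UNIV"
  proof (rule summable_on_comparison_test)
    fix n
    have "(cmod (fcoeff (f + g) n))\<^sup>2 \<le> (cmod (fcoeff f n) + cmod (fcoeff g n))\<^sup>2"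
      unfolding fcoeff_add by (intro power_mono norm_triangle_ineq) auto
    also have "\<dots> \<le> 2 * ((cmod (fcoeff f n))\<^sup>2 + (cmod (fcoeff g n))\<^sup>2)"
      using sum_squares_bound[of "cmod (fcoeff f n)" "cmod (fcoeff g n)"]
      by (simp add: power2_sum)
    finally have "?w n * (cmod (fcoeff (f + g) n))\<^sup>2 \<le>
        ?w n * (2 * ((cmod (fcoeff f n))\<^sup>2 + (cmod (fcoeff g n))\<^sup>2))"
      by (rule mult_left_mono) simp
    then show "?w n * (cmod (fcoeff (f + g) n))\<^sup>2 \<le>
        2 * (?w n * (cmod (fcoeff f n))\<^sup>2 + ?w n * (cmod (fcoeff g n))\<^sup>2)"
      by (simp add: algebra_simps)
  qed simp
  then show ?thesis by (simp add: Hper_def)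
qed

lemma Hper_diff: "f \<in> Hper s \<Longrightarrow> g \<in> Hper s \<Longrightarrow> f - g \<in> Hper s"
  unfolding minus_pdist_def by (intro Hper_add Hper_scaleR)

lemma Hnorm_nonneg [simp]: "0 \<le> Hnorm s f"
  unfolding Hnorm_def by (intro real_sqrt_ge_zero mult_nonneg_nonneg infsum_nonneg) auto

lemma Hnorm_scaleR: "Hnorm s (c *\<^sub>R f) = \<bar>c\<bar> * Hnorm s f"
proof -
  let ?S = "\<Sum>\<^sub>\<infinity>n::int. (1 + (of_int n)\<^sup>2) powr s * (cmod (fcoeff f n))\<^sup>2"
  have "(\<Sum>\<^sub>\<infinity>n::int. (1 + (of_int n)\<^sup>2) powr s * (cmod (fcoeff (c *\<^sub>R f) n))\<^sup>2) = c\<^sup>2 * ?S"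
    by (subst infsum_cmult_right'[symmetric])
      (simp add: fcoeff_scaleR power_mult_distrib mult.left_commute)
  then show ?thesis
    by (simp add: Hnorm_def real_sqrt_mult mult_ac)
qed

text \<open>One term of a nonnegative sum is at most the whole sum, and the factor
  \<open>2 * pi\<close> is at least 1. This makes each Fourier coefficient a bounded functional, the
  only route by which norm estimates reach coefficients below.\<close>

lemma norm_fcoeff_le_Hnorm:
  assumes "f \<in> Hper s"
  shows "cmod (fcoeff f n) \<le> (1 + (of_int n)\<^sup>2) powr (- s / 2) * Hnorm s f"
proof -
  define w where "w k = (1 + (of_int k)\<^sup>2 :: real) powr s" for k :: int
  have w: "w n > 0"
    unfolding w_def powr_gt_zero by (smt (verit) zero_le_power2)
  have "w n * (cmod (fcoeff f n))\<^sup>2 = (\<Sum>k\<in>{n}. w k * (cmod (fcoeff f k))\<^sup>2)"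
    by simp
  also have "\<dots> \<le> (\<Sum>\<^sub>\<infinity>k. w k * (cmod (fcoeff f k))\<^sup>2)"
    using assms by (intro finite_sum_le_infsum) (auto simp: Hper_def w_def)
  also have "\<dots> \<le> 2 * pi * (\<Sum>\<^sub>\<infinity>k. w k * (cmod (fcoeff f k))\<^sup>2)"
    using mult_right_mono[of 1 "2 * pi" "\<Sum>\<^sub>\<infinity>k. w k * (cmod (fcoeff f k))\<^sup>2"] pi_ge_two
    by (simp add: infsum_nonneg w_def)
  finally have "sqrt (w n * (cmod (fcoeff f n))\<^sup>2) \<le> Hnorm s f"
    unfolding Hnorm_def w_def[symmetric] by (rule real_sqrt_le_mono)
  then have "sqrt (w n) * cmod (fcoeff f n) \<le> Hnorm s f"
    by (simp add: real_sqrt_mult)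
  then have "(1 + (of_int n)\<^sup>2) powr (- s / 2) * (sqrt (w n) * cmod (fcoeff f n)) \<le>
      (1 + (of_int n)\<^sup>2) powr (- s / 2) * Hnorm s f"
    by (rule mult_left_mono) simp
  moreover have "(1 + (of_int n)\<^sup>2 :: real) powr (- s / 2) * sqrt (w n) = 1"
  proof -
    have "0 < (1 + (of_int n)\<^sup>2 :: real)"
      by (smt (verit) zero_le_power2)
    moreover have "sqrt (w n) = (1 + (of_int n)\<^sup>2) powr (s / 2)"
      unfolding w_def by (subst powr_half_sqrt[symmetric]) (simp_all add: powr_powr)
    ultimately show ?thesis
      by (simp add: powr_add[symmetric])
  qed
  ultimately show ?thesis
    by (simp add: mult.assoc[symmetric])
qed

text \<open>Turns the unordered sum over the integers into a series over the naturals, where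
  comparison with geometric series and Tannery's theorem apply.\<close>

lemma Hnorm_onesided:
  assumes f: "\<And>k. fcoeff f k = (if 0 \<le> k then b (nat k) else 0)"
    and b: "summable (\<lambda>n. (1 + (real n)\<^sup>2) powr s * (cmod (b n))\<^sup>2)"
  shows "f \<in> Hper s"
    and "Hnorm s f = sqrt (2 * pi * (\<Sum>n. (1 + (real n)\<^sup>2) powr s * (cmod (b n))\<^sup>2))"
proof -
  let ?w = "\<lambda>n::int. (1 + (of_int n)\<^sup>2 :: real) powr s"
  let ?S = "\<Sum>n. (1 + (real n)\<^sup>2) powr s * (cmod (b n))\<^sup>2"
  have "((\<lambda>n. (1 + (real n)\<^sup>2) powr s * (cmod (b n))\<^sup>2) has_sum ?S) UNIV"
    using b by (intro sums_nonneg_imp_has_sum summable_sums) auto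
  then have "(((\<lambda>k. ?w k * (cmod (fcoeff f k))\<^sup>2) \<circ> int) has_sum ?S) UNIV"
    by (simp add: o_def f)
  then have "((\<lambda>k. ?w k * (cmod (fcoeff f k))\<^sup>2) has_sum ?S) (range int)"
    by (subst has_sum_reindex) (auto simp: inj_on_def)
  moreover have "fcoeff f k = 0" if "k \<notin> range int" for k
    using that f by (metis nonneg_int_cases rangeI)
  ultimately have "((\<lambda>k. ?w k * (cmod (fcoeff f k))\<^sup>2) has_sum ?S) UNIV"
    by (subst has_sum_cong_neutral[where T = "range int"
          and g = "\<lambda>k. ?w k * (cmod (fcoeff f k))\<^sup>2"]) auto
  then show "f \<in> Hper s" "Hnorm s f = sqrt (2 * pi * ?S)"
    by (auto simp: Hper_def Hnorm_def has_sum_imp_summable dest: infsumI)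
qed

section \<open>Solutions with positive frequencies\<close>

text \<open>A nonzero term needs \<open>k > 0\<close> and \<open>n - k > 0\<close>. These
  frequencies lie within the truncation once \<open>K\<close> reaches \<open>\<bar>n\<bar>\<close>,
  so the truncated product is then already the full finite convolution.\<close>

lemma trunc_nonlin_onesided:
  assumes f: "\<And>k. fcoeff f k = (if 0 \<le> k then b (nat k) else 0)" and "b 0 = 0"
    and K: "\<bar>n\<bar> \<le> int K"
  shows "trunc_nonlin K f n =
    (if 0 \<le> n then \<Sum>k\<in>{1..<nat n}. b (nat n - k) * (\<i> * of_nat k * b k) else 0)"
proof -
  let ?A = "{k. \<bar>k\<bar> \<le> int K \<and> \<bar>n - k\<bar> \<le> int K}"
  let ?g = "\<lambda>k. fcoeff f (n - k) * (\<i> * of_int k * fcoeff f k)"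
  have fin: "finite ?A"
    by (rule finite_subset[of _ "{- int K..int K}"]) auto
  have f0: "fcoeff f k = 0" if "k \<le> 0" for k
    using f[of k] that \<open>b 0 = 0\<close> by auto
  show ?thesis
  proof (cases "0 \<le> n")
    case True
    have "sum ?g ?A = sum ?g (int ` {1..<nat n})"
    proof (rule sum.mono_neutral_right[OF fin])
      show "int ` {1..<nat n} \<subseteq> ?A"
        using K by auto
      show "\<forall>k\<in>?A - int ` {1..<nat n}. ?g k = 0"
      proof
        fix k assume k: "k \<in> ?A - int ` {1..<nat n}"
        have "k \<le> 0 \<or> n - k \<le> 0"
        proof (rule ccontr)
          assume "\<not> ?thesis"
          then have "k = int (nat k)" "nat k \<in> {1..<nat n}" by auto
          with k show False by blast
        qed
        then show "?g k = 0" using f0 by auto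
      qed
    qed
    also have "\<dots> = (\<Sum>k\<in>{1..<nat n}. ?g (int k))"
      by (subst sum.reindex) (auto simp: inj_on_def)
    also have "\<dots> = (\<Sum>k\<in>{1..<nat n}. b (nat n - k) * (\<i> * of_nat k * b k))"
      using True by (intro sum.cong) (auto simp: f nat_diff_distrib)
    finally show ?thesis
      using True by (simp add: trunc_nonlin_def)
  next
    case False
    have "?g k = 0" for k
      using f0[of k] f0[of "n - k"] False by (cases "k \<le> 0") auto
    then show ?thesis
      unfolding trunc_nonlin_def using False by (simp only: sum.neutral_const if_False)
  qed
qed

lemma weight_le_1: "s \<le> 0 \<Longrightarrow> (1 + (x::real)\<^sup>2) powr s \<le> 1"
  using powr_mono[of s 0 "1 + x\<^sup>2"] by (simp split: if_splits)

lemma weighted_square_le: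
  fixes z :: complex
  assumes "s \<le> 0" "cmod z \<le> B * (1 / 2) ^ n"
  shows "(1 + (x::real)\<^sup>2) powr s * (cmod z)\<^sup>2 \<le> B\<^sup>2 * (1 / 4) ^ n"
proof -
  have "(1 + x\<^sup>2) powr s * (cmod z)\<^sup>2 \<le> 1 * (B * (1 / 2) ^ n)\<^sup>2"
    using assms weight_le_1 by (intro mult_mono power_mono) auto
  also have "\<dots> = B\<^sup>2 * (1 / 4) ^ n"
    by (simp add: power_mult_distrib power2_eq_square flip: power_mult_distrib)
  finally show ?thesis .
qed

lemma summable_geometric_bound:
  fixes b :: "nat \<Rightarrow> 'a::banach" and q :: real
  assumes "\<And>n. norm (b n) \<le> B * q ^ n" "0 \<le> q" "q < 1"
  shows "summable (\<lambda>n. norm (b n))"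
  by (rule summable_comparison_test'[where g = "\<lambda>n. B * q ^ n"])
    (use assms in \<open>auto intro!: summable_mult summable_geometric\<close>)

text \<open>The condition on \<open>r + A * T\<close> makes the majorant geometric with ratio
  \<open>1 / 2\<close>, uniformly on \<open>{-T..T}\<close>. The recursively defined coefficients
  thus form a continuous curve in the space, and they satisfy the Duhamel formula by
  construction.\<close>

lemma ex_solution_onesided:
  assumes "T > 0" "s \<le> 0" "a 0 = 0"
    and a: "\<And>n. n \<ge> 1 \<Longrightarrow> cmod (a n) \<le> A * r ^ (n - 1)"
    and "0 \<le> A" "0 \<le> r" "r + A * T \<le> 1 / 2"
    and \<phi>: "\<And>k. fcoeff \<phi> k = (if 0 \<le> k then a (nat k) else 0)"
  obtains u where "solution s T \<phi> u"
    and "\<And>t k. t \<in> {-T..T} \<Longrightarrow> fcoeff (u t) k = (if 0 \<le> k then oneside a (nat k) t else 0)"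
proof -
  define u where "u t = pdist_of_coeffs (\<lambda>n. oneside a n t)" for t
  have v0: "oneside a 0 t = 0" for t
    using \<open>a 0 = 0\<close> by (subst oneside.simps) simp
  \<comment> \<open>The factor 2 turns \<open>(1 / 2) ^ (n - 1)\<close> into
    \<open>(1 / 2) ^ n\<close>; mode 0 vanishes.\<close>
  have bound: "cmod (oneside a n t) \<le> (2 * A) * (1 / 2) ^ n" if t: "t \<in> {-T..T}" for n t
  proof (cases n)
    case (Suc m)
    have "A * \<bar>t\<bar> \<le> A * T"
      using t \<open>0 \<le> A\<close> by (intro mult_left_mono) auto
    then have "A * (r + A * \<bar>t\<bar>) ^ m \<le> A * (1 / 2) ^ m"
      using assms by (intro mult_left_mono power_mono) auto
    then show ?thesis
      using norm_oneside_le[OF a \<open>0 \<le> A\<close> \<open>0 \<le> r\<close>, of n t] Suc by simp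
  qed (use v0 \<open>0 \<le> A\<close> in simp)
  have fu: "fcoeff (u t) k = (if 0 \<le> k then oneside a (nat k) t else 0)" if "t \<in> {-T..T}" for t k
    unfolding u_def
    by (rule fcoeff_pdist_of_coeffs[OF summable_geometric_bound[OF bound[OF that]]]) auto
  have Hper: "u t \<in> Hper s" if t: "t \<in> {-T..T}" for t
  proof (rule Hnorm_onesided(1)[OF fu[OF t]])
    have "norm ((1 + (real n)\<^sup>2) powr s * (cmod (oneside a n t))\<^sup>2) \<le> (2 * A)\<^sup>2 * (1 / 4) ^ n" for n
      using weighted_square_le[OF \<open>s \<le> 0\<close> bound[OF t]] by simp
    from summable_geometric_bound[OF this]
    show "summable (\<lambda>n. (1 + (real n)\<^sup>2) powr s * (cmod (oneside a n t))\<^sup>2)" by simp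
  qed
  \<comment> \<open>Each coefficient is continuous in time and the squared differences have a
    summable majorant independent of \<open>r\<close>, so Tannery's theorem allows the limit inside
    the series.\<close>
  have cont: "((\<lambda>r. Hnorm s (u r - u t)) \<longlongrightarrow> 0) (at t within {-T..T})" if t: "t \<in> {-T..T}" for t
  proof -
    let ?F = "at t within {-T..T}"
    define d where "d n r = (1 + (real n)\<^sup>2) powr s * (cmod (oneside a n r - oneside a n t))\<^sup>2" for n r
    have d_le: "norm (d n r) \<le> (4 * A)\<^sup>2 * (1 / 4) ^ n" if r: "r \<in> {-T..T}" for n r
    proof -
      have "cmod (oneside a n r - oneside a n t) \<le> (4 * A) * (1 / 2) ^ n"
        using norm_triangle_ineq4[of "oneside a n r" "oneside a n t"] bound[OF r, of n] bound[OF t, of n]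
        by simp
      from weighted_square_le[OF \<open>s \<le> 0\<close> this, of "real n"] show ?thesis
        by (simp add: d_def)
    qed
    have norm_eq: "Hnorm s (u r - u t) = sqrt (2 * pi * (\<Sum>n. d n r))" if r: "r \<in> {-T..T}" for r
    proof -
      have "summable (\<lambda>n. d n r)"
        using summable_geometric_bound[OF d_le[OF r]] by (simp add: summable_norm_cancel)
      then show ?thesis
        unfolding d_def
        by (intro Hnorm_onesided(2)) (auto simp: fcoeff_diff fu[OF r] fu[OF t])
    qed
    have in_F: "\<forall>\<^sub>F r in ?F. r \<in> {-T..T}"
      by (auto simp: eventually_at_filter)
    have "?F \<noteq> bot"
      using t \<open>T > 0\<close> by (simp add: trivial_limit_within islimpt_Icc)
    moreover have "\<forall>\<^sub>F (n, r) in at_top \<times>\<^sub>F ?F. norm (d n r) \<le> (4 * A)\<^sup>2 * (1 / 4) ^ n"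
      using eventually_prodI[OF eventually_True in_F]
    proof eventually_elim
      case (elim p)
      then show ?case
        using d_le[of "snd p" "fst p"] by (simp add: case_prod_beta)
    qed
    moreover have "((\<lambda>r. d n r) \<longlongrightarrow> 0) ?F" for n
    proof -
      have "continuous (at t within {-T..T}) (\<lambda>r. d n r)"
        unfolding d_def using continuous_on_oneside[of a n]
        by (intro continuous_intros) (auto simp: continuous_on_eq_continuous_within
            intro: continuous_within_subset)
      then show ?thesis by (simp add: continuous_within d_def)
    qed
    moreover have "summable (\<lambda>n. (4 * A)\<^sup>2 * (1 / 4 :: real) ^ n)"
      by (intro summable_mult summable_geometric) simp
    ultimately have "((\<lambda>r. \<Sum>n. d n r) \<longlongrightarrow> (\<Sum>n. 0)) ?F"
      using tannerys_theorem[of d "\<lambda>_. 0" ?F "\<lambda>n. (4 * A)\<^sup>2 * (1 / 4) ^ n"] by blast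
    then have "((\<lambda>r. sqrt (2 * pi * (\<Sum>n. d n r))) \<longlongrightarrow> sqrt (2 * pi * 0)) ?F"
      by (intro tendsto_intros) simp
    then show ?thesis
      using in_F by (auto elim!: Lim_transform_eventually eventually_mono simp: norm_eq)
  qed
  have duhamel: "\<exists>w. duhamel_term u t w \<and> (\<forall>n. fcoeff (u t) n = S_symbol t n * fcoeff \<phi> n - fcoeff w n)"
    if t: "t \<in> {-T..T}" for t
  proof -
    \<comment> \<open>The Duhamel formula forces these coefficients; the recursion identifies them
      with the integrals.\<close>
    define w where "w = pdist_of_coeffs (\<lambda>n. S_symbol t n * a n - oneside a n t)"
    \<comment> \<open>The bound on the solution at time 0, where the integral vanishes and the
      coefficient is \<open>a n\<close>.\<close>
    have a_le: "cmod (a n) \<le> (2 * A) * (1 / 2) ^ n" for n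
      using bound[of 0 n] \<open>T > 0\<close> by (simp add: oneside_factored zero_ereal_def)
    have "cmod (S_symbol t n * a n - oneside a n t) \<le> (4 * A) * (1 / 2) ^ n" for n
      using norm_triangle_ineq4[of "S_symbol t n * a n" "oneside a n t"] bound[OF t, of n] a_le[of n]
      by (simp add: norm_mult)
    then have fw: "fcoeff w n =
        (if 0 \<le> n then S_symbol t (int (nat n)) * a (nat n) - oneside a (nat n) t else 0)" for n
      unfolding w_def by (intro fcoeff_pdist_of_coeffs summable_geometric_bound) auto
    have "(\<lambda>K. LBINT \<tau>=0..t. S_symbol (t - \<tau>) n * Lambda_symbol n * trunc_nonlin K (u \<tau>) n)
        \<longlonglongrightarrow> fcoeff w n" for n
    \<comment> \<open>The sequence of truncated integrals is constant from
      \<open>K = nat \<bar>n\<bar>\<close> on.\<close>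
    proof (rule tendsto_eventually)
      have "(LBINT \<tau>=0..t. S_symbol (t - \<tau>) n * Lambda_symbol n * trunc_nonlin K (u \<tau>) n) =
          fcoeff w n" if K: "nat \<bar>n\<bar> \<le> K" for K
      proof -
        have trunc: "trunc_nonlin K (u \<tau>) n =
            (if 0 \<le> n then oneside_nonlin a (nat n) \<tau> else 0)" if "\<tau> \<in> {-T..T}" for \<tau>
          unfolding oneside_nonlin_def using K
          by (intro trunc_nonlin_onesided fu[OF that] v0) auto
        have "(LBINT \<tau>=0..t. S_symbol (t - \<tau>) n * Lambda_symbol n * trunc_nonlin K (u \<tau>) n) =
          (LBINT \<tau>=0..t. S_symbol (t - \<tau>) n * Lambda_symbol n *
            (if 0 \<le> n then oneside_nonlin a (nat n) \<tau> else 0))"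
        proof (rule interval_integral_cong)
          fix \<tau> assume "\<tau> \<in> einterval (min 0 (ereal t)) (max 0 (ereal t))"
          then have "\<tau> \<in> {-T..T}"
            using t by (cases "0 \<le> t") (auto simp: einterval_def min_def max_def split: if_splits)
          then show "S_symbol (t - \<tau>) n * Lambda_symbol n * trunc_nonlin K (u \<tau>) n =
              S_symbol (t - \<tau>) n * Lambda_symbol n *
                (if 0 \<le> n then oneside_nonlin a (nat n) \<tau> else 0)"
            by (simp only: trunc)
        qed
        also have "\<dots> = fcoeff w n"
        proof (cases "0 \<le> n")
          case True
          then show ?thesis
            using oneside.simps[of a "nat n" t] by (simp add: fw oneside_nonlin_def)
        qed (simp add: fw)
        finally show ?thesis .
      qed
      then show "\<forall>\<^sub>F K in sequentially. (LBINT \<tau>=0..t. S_symbol (t - \<tau>) n * Lambda_symbol n *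
          trunc_nonlin K (u \<tau>) n) = fcoeff w n"
        unfolding eventually_sequentially by blast
    qed
    then have "duhamel_term u t w"
      by (simp add: duhamel_term_def)
    moreover have "fcoeff (u t) n = S_symbol t n * fcoeff \<phi> n - fcoeff w n" for n
      by (simp add: fu[OF t] fw \<phi>)
    ultimately show ?thesis by blast
  qed
  show thesis
    using that[of u] fu Hper cont duhamel by (auto simp: solution_def)
qed

section \<open>The second derivative of the flow\<close>

text \<open>Otherwise take \<epsilon> to be a third of \<open>cmod z\<close>, and \<eta> so small
  that the quadratic part contributes at most another third: together they cannot account for
  \<open>z\<close>.\<close>

lemma eq_0_if_small_linear_part:
  fixes z c :: complex
  assumes small: "\<And>\<epsilon>. \<epsilon> > 0 \<Longrightarrow> \<exists>d>0. \<forall>\<eta>. 0 < \<eta> \<longrightarrow> \<eta> < d \<longrightarrow>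
    cmod (of_real \<eta> * z + (of_real \<eta>)\<^sup>2 * c) \<le> \<epsilon> * \<eta>"
  shows "z = 0"
proof (rule ccontr)
  assume "z \<noteq> 0"
  then obtain d where d: "d > 0"
    "\<And>\<eta>. 0 < \<eta> \<Longrightarrow> \<eta> < d \<Longrightarrow> cmod (of_real \<eta> * z + (of_real \<eta>)\<^sup>2 * c) \<le> cmod z / 3 * \<eta>"
    using small[of "cmod z / 3"] by auto
  obtain \<eta> where \<eta>: "0 < \<eta>" "\<eta> < d" "\<eta> < cmod z / (3 * (cmod c + 1))"
    using field_lbound_gt_zero[OF d(1), of "cmod z / (3 * (cmod c + 1))"] \<open>z \<noteq> 0\<close>
    by (auto simp: add_nonneg_pos)
  have "\<eta> * cmod (z + of_real \<eta> * c) \<le> cmod z / 3 * \<eta>"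
    using d(2)[OF \<eta>(1,2)] \<eta>(1)
    by (simp add: power2_eq_square mult.assoc norm_mult flip: distrib_left)
  then have "cmod (z + of_real \<eta> * c) \<le> cmod z / 3"
    using \<eta>(1) by (simp add: mult.commute)
  moreover have "cmod (of_real \<eta> * c) \<le> cmod z / 3"
  proof -
    have "\<eta> * (3 * (cmod c + 1)) < cmod z"
      using \<eta>(3) by (subst (asm) pos_less_divide_eq) (auto simp: add_nonneg_pos)
    then show ?thesis using \<eta>(1) by (simp add: norm_mult algebra_simps)
  qed
  moreover have "cmod z \<le> cmod (z + of_real \<eta> * c) + cmod (of_real \<eta> * c)"
    using norm_triangle_ineq4[of "z + of_real \<eta> * c" "of_real \<eta> * c"] by simp
  moreover have "cmod z > 0" using \<open>z \<noteq> 0\<close> by simp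
  ultimately show False by linarith
qed

text \<open>The \<open>m\<close>-th coefficient is a bounded functional, so it carries both
  remainder estimates to complex numbers. Along the real line through \<open>e\<close> the
  coefficient is \<open>\<gamma>\<^sup>2 * c\<close>: its derivative is
  \<open>2 * \<gamma> * c\<close> at each small \<gamma>, and differentiating this at 0 gives
  \<open>2 * c\<close>.\<close>

lemma fcoeff_second_derivative:
  assumes "r > 0"
    and D1: "\<And>x. x \<in> Hper s \<Longrightarrow> Hnorm s x < r \<Longrightarrow> frechet_deriv_on (Hper s) (Hnorm s) f (D1 x) x"
    and D2: "frechet_deriv_op_on (Hper s) (Hnorm s) D1 D2 0"
    and e: "e \<in> Hper s"
    and "\<gamma>0 > 0"
    and quadratic: "\<And>\<gamma>. \<bar>\<gamma>\<bar> < \<gamma>0 \<Longrightarrow> fcoeff (f (\<gamma> *\<^sub>R e)) m = (of_real \<gamma>)\<^sup>2 * c"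
  shows "fcoeff (D2 e e) m = 2 * c"
proof -
  define K where "K = (1 + (of_int m)\<^sup>2 :: real) powr (- s / 2)"
  define E where "E = Hnorm s e"
  have K: "cmod (fcoeff g m) \<le> K * Hnorm s g" if "g \<in> Hper s" for g
    unfolding K_def by (rule norm_fcoeff_le_Hnorm[OF that])
  have "K > 0"
    unfolding K_def powr_gt_zero by (smt (verit) zero_le_power2)
  have "E \<ge> 0" by (simp add: E_def)
  \<comment> \<open>Keeps \<open>\<gamma> *\<^sub>R e\<close> in the ball of differentiability and
    \<gamma> in the range of the quadratic formula. The 1 added to \<open>E\<close> avoids division
    by zero.\<close>
  define \<gamma>1 where "\<gamma>1 = min \<gamma>0 (r / (E + 1))"
  have "\<gamma>1 > 0" using \<open>\<gamma>0 > 0\<close> \<open>r > 0\<close> \<open>E \<ge> 0\<close> by (simp add: \<gamma>1_def)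
  have scaled_lt: "Hnorm s (\<gamma> *\<^sub>R e) < d" if "\<bar>\<gamma>\<bar> < d / (E + 1)" for \<gamma> d
  proof -
    have "\<bar>\<gamma>\<bar> * E \<le> \<bar>\<gamma>\<bar> * (E + 1)" by (intro mult_left_mono) auto
    also have "\<dots> < d" using that \<open>E \<ge> 0\<close> by (simp add: field_simps)
    finally show ?thesis by (simp add: Hnorm_scaleR E_def)
  qed
  have zero: "0 \<in> Hper s" "Hnorm s 0 = 0"
    using Hper_scaleR[OF e, of 0] Hnorm_scaleR[of s 0 e] by auto
  have deriv: "frechet_deriv_on (Hper s) (Hnorm s) f (D1 (\<gamma> *\<^sub>R e)) (\<gamma> *\<^sub>R e)" if "\<bar>\<gamma>\<bar> < \<gamma>1" for \<gamma>
    using that by (intro D1 Hper_scaleR e scaled_lt) (simp add: \<gamma>1_def)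
  then have lin: "bdd_linear_on (Hper s) (Hnorm s) (D1 (\<gamma> *\<^sub>R e))" if "\<bar>\<gamma>\<bar> < \<gamma>1" for \<gamma>
    using that by (simp add: frechet_deriv_on_def)
  have first: "fcoeff (D1 (\<gamma> *\<^sub>R e) e) m = 2 * of_real \<gamma> * c" if \<gamma>: "\<bar>\<gamma>\<bar> < \<gamma>1" for \<gamma>
  proof -
    have "2 * of_real \<gamma> * c - fcoeff (D1 (\<gamma> *\<^sub>R e) e) m = 0"
    proof (rule eq_0_if_small_linear_part[where c = c])
      fix \<epsilon> :: real assume "\<epsilon> > 0"
      \<comment> \<open>Chosen so that the coefficient bound
        \<open>K * (\<epsilon>' * (\<eta> * E))\<close> is at most
        \<open>\<epsilon> * \<eta>\<close>.\<close>
      define \<epsilon>' where "\<epsilon>' = \<epsilon> / (K * (E + 1))"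
      have "\<epsilon>' > 0" using \<open>\<epsilon> > 0\<close> \<open>K > 0\<close> \<open>E \<ge> 0\<close> by (simp add: \<epsilon>'_def)
      then obtain d where "d > 0" and d: "\<And>h. h \<in> Hper s \<Longrightarrow> Hnorm s h < d \<Longrightarrow>
          f (\<gamma> *\<^sub>R e + h) \<in> Hper s \<and>
          Hnorm s (f (\<gamma> *\<^sub>R e + h) - f (\<gamma> *\<^sub>R e) - D1 (\<gamma> *\<^sub>R e) h) \<le> \<epsilon>' * Hnorm s h"
        using deriv[OF \<gamma>] unfolding frechet_deriv_on_def by blast
      \<comment> \<open>The increment \<open>h = 0\<close> in the remainder clause yields membership
        of the base value.\<close>
      have f_mem: "f (\<gamma> *\<^sub>R e) \<in> Hper s"
        using d[of 0] zero \<open>d > 0\<close> by simp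
      have "cmod (of_real \<eta> * (2 * of_real \<gamma> * c - fcoeff (D1 (\<gamma> *\<^sub>R e) e) m) + (of_real \<eta>)\<^sup>2 * c) \<le> \<epsilon> * \<eta>"
        if \<eta>: "0 < \<eta>" "\<eta> < min (d / (E + 1)) (\<gamma>0 - \<bar>\<gamma>\<bar>)" for \<eta>
      proof -
        define R where "R = f (\<gamma> *\<^sub>R e + \<eta> *\<^sub>R e) - f (\<gamma> *\<^sub>R e) - D1 (\<gamma> *\<^sub>R e) (\<eta> *\<^sub>R e)"
        have h: "\<eta> *\<^sub>R e \<in> Hper s" "Hnorm s (\<eta> *\<^sub>R e) < d"
          using \<eta> by (auto intro!: Hper_scaleR e scaled_lt)
        have D1_scale: "D1 (\<gamma> *\<^sub>R e) (\<eta> *\<^sub>R e) = \<eta> *\<^sub>R D1 (\<gamma> *\<^sub>R e) e"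
          "D1 (\<gamma> *\<^sub>R e) (\<eta> *\<^sub>R e) \<in> Hper s"
          using lin[OF \<gamma>] h e by (auto simp: bdd_linear_on_def)
        have "R \<in> Hper s"
          unfolding R_def using d[OF h] f_mem D1_scale(2) by (intro Hper_diff) auto
        then have "cmod (fcoeff R m) \<le> K * Hnorm s R"
          by (rule K)
        also have "\<dots> \<le> K * (\<epsilon>' * (\<eta> * E))"
          using d[OF h] \<open>K > 0\<close> \<eta> by (intro mult_left_mono) (auto simp: R_def Hnorm_scaleR E_def)
        also have "\<dots> = \<epsilon> * \<eta> * (E / (E + 1))"
          using \<open>K > 0\<close> by (simp add: \<epsilon>'_def)
        also have "\<dots> \<le> \<epsilon> * \<eta> * 1"
          using \<open>E \<ge> 0\<close> \<open>\<epsilon> > 0\<close> \<eta> by (intro mult_left_mono) auto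
        finally have "cmod (fcoeff R m) \<le> \<epsilon> * \<eta>" by simp
        \<comment> \<open>The difference of squares is
          \<open>2 * \<gamma> * \<eta> + \<eta>\<^sup>2\<close>, which gives the remainder the
          linear plus quadratic form of the auxiliary lemma.\<close>
        moreover have "fcoeff R m = (of_real (\<gamma> + \<eta>))\<^sup>2 * c - (of_real \<gamma>)\<^sup>2 * c
            - of_real \<eta> * fcoeff (D1 (\<gamma> *\<^sub>R e) e) m"
          unfolding R_def D1_scale(1) scaleR_add_left[symmetric] fcoeff_diff fcoeff_scaleR
          using \<gamma> \<eta> by (subst (1 2) quadratic) (auto simp: \<gamma>1_def scaleR_conv_of_real)
        ultimately show ?thesis
          by (simp add: power2_eq_square algebra_simps)
      qed
      moreover have "0 < min (d / (E + 1)) (\<gamma>0 - \<bar>\<gamma>\<bar>)"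
        using \<open>d > 0\<close> \<open>E \<ge> 0\<close> \<gamma> by (simp add: \<gamma>1_def)
      ultimately show "\<exists>d>0. \<forall>\<eta>. 0 < \<eta> \<longrightarrow> \<eta> < d \<longrightarrow> cmod (of_real \<eta> *
          (2 * of_real \<gamma> * c - fcoeff (D1 (\<gamma> *\<^sub>R e) e) m) + (of_real \<eta>)\<^sup>2 * c) \<le> \<epsilon> * \<eta>"
        by blast
    qed
    then show ?thesis by simp
  qed
  have "2 * c - fcoeff (D2 e e) m = 0"
  \<comment> \<open>The first derivative is already linear in \<eta>, so no quadratic part
    remains.\<close>
  proof (rule eq_0_if_small_linear_part[where c = 0])
    fix \<epsilon> :: real assume "\<epsilon> > 0"
    define \<epsilon>' where "\<epsilon>' = \<epsilon> / (K * (E * E + 1))"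
    have E2: "E * E + 1 > 0" by (simp add: add_nonneg_pos)
    have "\<epsilon>' > 0" using \<open>\<epsilon> > 0\<close> \<open>K > 0\<close> E2 by (simp add: \<epsilon>'_def)
    then obtain d where "d > 0" and d: "\<And>h k. h \<in> Hper s \<Longrightarrow> Hnorm s h < d \<Longrightarrow> k \<in> Hper s \<Longrightarrow>
        Hnorm s (D1 (0 + h) k - D1 0 k - D2 h k) \<le> \<epsilon>' * Hnorm s h * Hnorm s k"
      using D2 unfolding frechet_deriv_op_on_def by blast
    have "cmod (of_real \<eta> * (2 * c - fcoeff (D2 e e) m) + (of_real \<eta>)\<^sup>2 * 0) \<le> \<epsilon> * \<eta>"
      if \<eta>: "0 < \<eta>" "\<eta> < min (d / (E + 1)) \<gamma>1" for \<eta>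
    proof -
      define R where "R = D1 (\<eta> *\<^sub>R e) e - D1 0 e - D2 (\<eta> *\<^sub>R e) e"
      have h: "\<eta> *\<^sub>R e \<in> Hper s" "Hnorm s (\<eta> *\<^sub>R e) < d"
        using \<eta> by (auto intro!: Hper_scaleR e scaled_lt)
      have D2_scale: "D2 (\<eta> *\<^sub>R e) e = \<eta> *\<^sub>R D2 e e" "D2 (\<eta> *\<^sub>R e) e \<in> Hper s"
        using D2 h e unfolding frechet_deriv_op_on_def bdd_linear_on_def by auto
      have "R \<in> Hper s"
        unfolding R_def using lin[of \<eta>] lin[of 0] D2_scale(2) \<eta> \<open>\<gamma>1 > 0\<close> e
        by (intro Hper_diff) (auto simp: bdd_linear_on_def)
      then have "cmod (fcoeff R m) \<le> K * Hnorm s R"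
        by (rule K)
      also have "\<dots> \<le> K * (\<epsilon>' * (\<eta> * E) * E)"
        using d[OF h e] \<open>K > 0\<close> \<eta> by (intro mult_left_mono) (auto simp: R_def Hnorm_scaleR E_def)
      also have "\<dots> = \<epsilon> * \<eta> * (E * E / (E * E + 1))"
        using \<open>K > 0\<close> by (simp add: \<epsilon>'_def)
      also have "\<dots> \<le> \<epsilon> * \<eta> * 1"
        using E2 \<open>\<epsilon> > 0\<close> \<eta> by (intro mult_left_mono) auto
      finally have "cmod (fcoeff R m) \<le> \<epsilon> * \<eta>" by simp
      moreover have "fcoeff R m = 2 * of_real \<eta> * c - of_real \<eta> * fcoeff (D2 e e) m"
        using first[of \<eta>] first[of 0] \<eta> \<open>\<gamma>1 > 0\<close>
        by (simp add: R_def D2_scale(1) fcoeff_diff fcoeff_scaleR scaleR_conv_of_real)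
      ultimately show ?thesis
        by (simp add: algebra_simps)
    qed
    moreover have "0 < min (d / (E + 1)) \<gamma>1"
      using \<open>d > 0\<close> \<open>E \<ge> 0\<close> \<open>\<gamma>1 > 0\<close> by simp
    ultimately show "\<exists>d>0. \<forall>\<eta>. 0 < \<eta> \<longrightarrow> \<eta> < d \<longrightarrow> cmod (of_real \<eta> *
        (2 * c - fcoeff (D2 e e) m) + (of_real \<eta>)\<^sup>2 * 0) \<le> \<epsilon> * \<eta>"
      by blast
  qed
  then show ?thesis by simp
qed

section \<open>The resonance integral at frequency \<open>2 * N\<close>\<close>

lemma norm_interval_integral_cis:
  assumes "\<delta> \<noteq> 0"
  shows "cmod (LBINT \<tau>=0..t. cis (- \<delta> * \<tau>)) = cmod (cis (- \<delta> * t) - 1) / \<bar>\<delta>\<bar>"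
proof -
  have "(LBINT \<tau>=ereal 0..ereal t. cis (- \<delta> * \<tau>)) =
      cis (- \<delta> * t) / (\<i> * of_real (- \<delta>)) - cis (- \<delta> * 0) / (\<i> * of_real (- \<delta>))"
  proof (rule interval_integral_FTC_finite)
    show "((\<lambda>x. cis (- \<delta> * x) / (\<i> * of_real (- \<delta>))) has_vector_derivative cis (- \<delta> * x))
        (at x within {min 0 t..max 0 t})" for x
      using has_vector_derivative_divide[OF has_vector_derivative_cis[of "- \<delta>" x "{min 0 t..max 0 t}"],
          of "\<i> * of_real (- \<delta>)"] assms by simp
  qed (intro continuous_intros)
  also have "\<dots> = (cis (- \<delta> * t) - 1) / (\<i> * of_real (- \<delta>))"
    by (simp add: diff_divide_distrib)
  finally show ?thesis
    by (simp add: zero_ereal_def norm_divide norm_mult)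
qed

lemma S_symbol_cis: "S_symbol t (int n) = cis (- (real n / (1 + real n)) * t)"
  by (simp add: S_symbol_def cis_conv_exp mult_ac)

text \<open>\<open>\<delta>\<close> is the resonance \<open>2 \<omega>(N) - \<omega>(2N)\<close> of the dispersion relation \<open>\<omega>(n) = n / (1 + n)\<close>.\<close>

lemma norm_oneside_double:
  fixes \<delta> :: real
  assumes a: "\<And>k. k \<noteq> N \<Longrightarrow> a k = 0" and "N \<ge> 1"
    and \<delta>: "\<delta> = 2 * (real N)\<^sup>2 / ((1 + real N) * (1 + 2 * real N))"
  shows "cmod (oneside a (2 * N) t) =
    (cmod (a N))\<^sup>2 * (real N / (1 + 2 * real N) * (cmod (cis (- \<delta> * t) - 1) / \<delta>))"
proof -
  have "\<delta> > 0"
    unfolding \<delta> using \<open>N \<ge> 1\<close> by (intro divide_pos_pos) auto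
  have "real (2 * N) / (1 + real (2 * N)) - 2 * (real N / (1 + real N)) = - \<delta>"
  proof -
    have "1 + real N \<noteq> 0" "1 + 2 * real N \<noteq> 0" by linarith+
    then show ?thesis
      unfolding \<delta> by (simp add: divide_simps) (simp add: algebra_simps power2_eq_square)
  qed
  moreover have "- q * - \<tau> + (- p * \<tau> + - p * \<tau>) = (q - 2 * p) * \<tau>" for p q \<tau> :: real
    by (simp add: algebra_simps)
  ultimately have "- (real (2 * N) / (1 + real (2 * N))) * - \<tau> +
      (- (real N / (1 + real N)) * \<tau> + - (real N / (1 + real N)) * \<tau>) = - \<delta> * \<tau>" for \<tau>
    by (simp only:)
  \<comment> \<open>The phases \<open>\<omega>(2N)\<close> and \<open>- 2 \<omega>(N)\<close> add up
    to \<open>- \<delta>\<close>, so the integrand is a single exponential.\<close>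
  then have "S_symbol (- \<tau>) (int (2 * N)) * (S_symbol \<tau> (int N))\<^sup>2 = cis (- \<delta> * \<tau>)" for \<tau>
    unfolding S_symbol_cis power2_eq_square cis_mult by (rule arg_cong)
  then have integrand: "S_symbol (- \<tau>) (int (2 * N)) * (Lambda_symbol (int (2 * N)) *
      (\<i> * of_nat N * (S_symbol \<tau> (int N))\<^sup>2)) =
      (Lambda_symbol (int (2 * N)) * \<i> * of_nat N) * cis (- \<delta> * \<tau>)" for \<tau>
    by (metis (no_types, opaque_lifting) mult.assoc mult.left_commute)
  have "Lambda_symbol (int (2 * N)) = of_real (1 / (1 + 2 * real N))"
    by (simp add: Lambda_symbol_def)
  then have "cmod (Lambda_symbol (int (2 * N))) = 1 / (1 + 2 * real N)"
    by (simp only: norm_of_real) simp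
  moreover have "oneside a (2 * N) t = - (a N)\<^sup>2 * S_symbol t (int (2 * N)) *
      ((Lambda_symbol (int (2 * N)) * \<i> * of_nat N) * (LBINT \<tau>=0..t. cis (- \<delta> * \<tau>)))"
    by (subst oneside_double[where N = N and a = a, OF a \<open>N \<ge> 1\<close>])
      (simp_all only: integrand interval_lebesgue_integral_mult_right not_False_eq_True)
  moreover have "cmod (LBINT \<tau>=0..t. cis (- \<delta> * \<tau>)) = cmod (cis (- \<delta> * t) - 1) / \<delta>"
    using norm_interval_integral_cis[of \<delta> t] \<open>\<delta> > 0\<close> by simp
  ultimately show ?thesis
    by (simp add: norm_mult norm_power del: mult_minus_left)
qed

theorem theorem4p2:
  fixes s :: real
  assumes "s < 0"
  shows "\<not> (\<exists>T>0. \<exists>\<epsilon>>0. \<exists>flow :: pdist \<Rightarrow> real \<Rightarrow> pdist.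
    (\<forall>\<phi>\<in>Hper s. Hnorm s \<phi> < \<epsilon> \<longrightarrow>
       solution s T \<phi> (flow \<phi>) \<and>
       (\<forall>v. solution s T \<phi> v \<longrightarrow> (\<forall>t\<in>{-T..T}. v t = flow \<phi> t))) \<and>
    (\<forall>t\<in>{-T..T}. C2_at_zero (Hper s) (Hnorm s) (\<lambda>\<phi>. flow \<phi> t)))"
proof (rule notI, elim exE conjE)
  fix T \<epsilon> :: real and flow :: "pdist \<Rightarrow> real \<Rightarrow> pdist"
  assume "T > 0" "\<epsilon> > 0"
    and flow: "\<forall>\<phi>\<in>Hper s. Hnorm s \<phi> < \<epsilon> \<longrightarrow> solution s T \<phi> (flow \<phi>) \<and>
       (\<forall>v. solution s T \<phi> v \<longrightarrow> (\<forall>t\<in>{-T..T}. v t = flow \<phi> t))"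
    and C2: "\<forall>t\<in>{-T..T}. C2_at_zero (Hper s) (Hnorm s) (\<lambda>\<phi>. flow \<phi> t)"
  \<comment> \<open>A positive time in the interval that is below \<open>pi\<close>, so that
    \<open>sin t > 0\<close> at the end.\<close>
  define t where "t = min T 1"
  have t: "t \<in> {-T..T}" "0 < t" "t \<le> 1"
    using \<open>T > 0\<close> by (auto simp: t_def)
  obtain r D1 D2 where "r > 0"
    and D: "\<And>x. x \<in> Hper s \<Longrightarrow> Hnorm s x < r \<Longrightarrow>
        frechet_deriv_on (Hper s) (Hnorm s) (\<lambda>\<phi>. flow \<phi> t) (D1 x) x \<and>
        frechet_deriv_op_on (Hper s) (Hnorm s) D1 (D2 x) x"
    using bspec[OF C2 t(1)] unfolding C2_at_zero_def by blast
  define e where "e N = pdist_of_coeffs (\<lambda>n. if n = N then 1 else 0)" for N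
  have fe: "fcoeff (e N) k = (if 0 \<le> k then if nat k = N then 1 else 0 else 0)" for N k
    unfolding e_def
    by (intro fcoeff_pdist_of_coeffs summable_finite[of "{N}"]) auto
  have e_summable: "summable (\<lambda>n. (1 + (real n)\<^sup>2) powr s * (cmod (if n = N then 1 else 0))\<^sup>2)" for N
    by (intro summable_finite[of "{N}"]) auto
  have e_mem: "e N \<in> Hper s" for N
    by (rule Hnorm_onesided(1)[OF fe e_summable])
  \<comment> \<open>For negative \<open>s\<close> these norms tend to 0 as \<open>N\<close> grows,
    which is what the second derivative cannot match.\<close>
  have e_norm: "(Hnorm s (e N))\<^sup>2 = 2 * pi * (1 + (real N)\<^sup>2) powr s" for N
  proof -
    have "(\<Sum>n. (1 + (real n)\<^sup>2) powr s * (cmod (if n = N then 1 else 0))\<^sup>2) =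
        (\<Sum>n\<in>{N}. (1 + (real n)\<^sup>2) powr s * (cmod (if n = N then 1 else 0))\<^sup>2)"
      by (rule suminf_finite) auto
    then show ?thesis
      unfolding Hnorm_onesided(2)[OF fe e_summable] by simp
  qed
  have zero: "0 \<in> Hper s" "Hnorm s 0 = 0"
    using Hper_scaleR[OF e_mem, of 0] Hnorm_scaleR[of s 0 "e 0"] by auto
  have D2: "frechet_deriv_op_on (Hper s) (Hnorm s) D1 (D2 0) 0"
    using D[of 0] zero \<open>r > 0\<close> by simp
  then obtain C where C: "\<And>h k. h \<in> Hper s \<Longrightarrow> k \<in> Hper s \<Longrightarrow>
      Hnorm s (D2 0 h k) \<le> C * Hnorm s h * Hnorm s k"
    unfolding frechet_deriv_op_on_def by blast
  define c where "c N = oneside (\<lambda>n. if n = N then 1 else 0) (2 * N) t" for N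
  have D2_coeff: "fcoeff (D2 0 (e N) (e N)) (int (2 * N)) = 2 * c N" if "N \<ge> 1" for N
  proof -
    \<comment> \<open>With decay rate \<open>r = 1 / 4\<close> this gives
      \<open>r + A * T = 1 / 2\<close>, as the existence lemma demands.\<close>
    define A where "A = 1 / (4 * T)"
    \<comment> \<open>The first bound makes the datum satisfy the decay hypothesis at its single
      mode \<open>N\<close>; the second keeps it in the ball where the flow is the unique
      solution.\<close>
    define \<gamma>0 where "\<gamma>0 = min (A * (1 / 4) ^ (N - 1)) (\<epsilon> / (Hnorm s (e N) + 1))"
    have "A > 0" using \<open>T > 0\<close> by (simp add: A_def)
    show ?thesis
    proof (rule fcoeff_second_derivative[OF \<open>r > 0\<close> _ D2 e_mem])
      show "\<gamma>0 > 0"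
        using \<open>A > 0\<close> \<open>\<epsilon> > 0\<close> by (simp add: \<gamma>0_def add_nonneg_pos)
      fix \<gamma> assume \<gamma>: "\<bar>\<gamma>\<bar> < \<gamma>0"
      define a :: "nat \<Rightarrow> complex" where "a n = (if n = N then of_real \<gamma> else 0)" for n
      have "\<bar>\<gamma>\<bar> * Hnorm s (e N) \<le> \<bar>\<gamma>\<bar> * (Hnorm s (e N) + 1)"
        by (intro mult_left_mono) auto
      also have "\<dots> < \<epsilon>"
        using \<gamma> by (simp add: \<gamma>0_def pos_less_divide_eq add_nonneg_pos)
      finally have small: "Hnorm s (\<gamma> *\<^sub>R e N) < \<epsilon>"
        by (simp add: Hnorm_scaleR)
      obtain u where "solution s T (\<gamma> *\<^sub>R e N) u"
        and u: "\<And>t k. t \<in> {-T..T} \<Longrightarrow> fcoeff (u t) k = (if 0 \<le> k then oneside a (nat k) t else 0)"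
      proof (rule ex_solution_onesided[of T s a A "1 / 4" "\<gamma> *\<^sub>R e N"])
        show "cmod (a n) \<le> A * (1 / 4) ^ (n - 1)" if "n \<ge> 1" for n
          using \<gamma> \<open>A > 0\<close> by (simp add: a_def \<gamma>0_def)
        show "fcoeff (\<gamma> *\<^sub>R e N) k = (if 0 \<le> k then a (nat k) else 0)" for k
          by (simp add: fcoeff_scaleR fe a_def scaleR_conv_of_real)
      qed (use \<open>T > 0\<close> \<open>s < 0\<close> \<open>A > 0\<close> \<open>N \<ge> 1\<close> in \<open>auto simp: a_def A_def\<close>)
      \<comment> \<open>Uniqueness identifies the explicit solution with the given flow.\<close>
      then have "u t = flow (\<gamma> *\<^sub>R e N) t"
        using flow Hper_scaleR[OF e_mem] small t(1) by blast
      then have "fcoeff (flow (\<gamma> *\<^sub>R e N) t) (int (2 * N)) = oneside a (2 * N) t"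
        using u[OF t(1), of "int (2 * N)"] by (simp only: nat_int of_nat_0_le_iff if_True)
      also have "\<dots> = (of_real \<gamma>)\<^sup>2 * c N"
        unfolding c_def using \<open>N \<ge> 1\<close>
        by (subst (1 2) oneside_double[where N = N]) (auto simp: a_def)
      finally show "fcoeff (flow (\<gamma> *\<^sub>R e N) t) (int (2 * N)) = (of_real \<gamma>)\<^sup>2 * c N" .
    qed (use D in blast)
  qed
  define \<delta> where "\<delta> N = 2 * (real N)\<^sup>2 / ((1 + real N) * (1 + 2 * real N))" for N
  \<comment> \<open>On the left the exact size of the coefficient at \<open>2 * N\<close> of the
    second derivative, on the right its bound by continuity of that bilinear map.\<close>
  have "2 * (real N / (1 + 2 * real N) * (cmod (cis (- \<delta> N * t) - 1) / \<delta> N)) \<le>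
      (1 + (2 * real N)\<^sup>2) powr (- s / 2) * (C * (2 * pi * (1 + (real N)\<^sup>2) powr s))"
    if "N \<ge> 1" for N
  proof -
    have "D2 0 (e N) (e N) \<in> Hper s"
      using D2 e_mem unfolding frechet_deriv_op_on_def bdd_linear_on_def by blast
    then have "cmod (fcoeff (D2 0 (e N) (e N)) (int (2 * N))) \<le>
        (1 + (of_int (int (2 * N)))\<^sup>2) powr (- s / 2) * Hnorm s (D2 0 (e N) (e N))"
      by (rule norm_fcoeff_le_Hnorm)
    also have "\<dots> \<le> (1 + (of_int (int (2 * N)))\<^sup>2) powr (- s / 2) * (C * Hnorm s (e N) * Hnorm s (e N))"
      by (intro mult_left_mono C e_mem) simp
    also have "C * Hnorm s (e N) * Hnorm s (e N) = C * (2 * pi * (1 + (real N)\<^sup>2) powr s)"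
      unfolding e_norm[symmetric] by (simp add: power2_eq_square)
    finally show ?thesis
      unfolding D2_coeff[OF that] norm_mult c_def using that
      by (subst (asm) norm_oneside_double[where N = N, OF _ _ \<delta>_def]) auto
  qed
  moreover have "(\<lambda>N. 2 * (real N / (1 + 2 * real N) * (cmod (cis (- \<delta> N * t) - 1) / \<delta> N)))
      \<longlonglongrightarrow> 2 * (1 / 2 * (cmod (cis (- 1 * t) - 1) / 1))"
  proof -
    have "\<delta> \<longlonglongrightarrow> 1"
      unfolding \<delta>_def by real_asymp
    then have "(\<lambda>N. cmod (cis (- \<delta> N * t) - 1) / \<delta> N) \<longlonglongrightarrow> cmod (cis (- 1 * t) - 1) / 1"
      by (intro tendsto_intros) auto
    moreover have "(\<lambda>N. real N / (1 + 2 * real N)) \<longlonglongrightarrow> 1 / 2"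
      by real_asymp
    ultimately show ?thesis
      by (intro tendsto_mult[OF tendsto_const] tendsto_mult)
  qed
  moreover have "(\<lambda>N. (1 + (2 * real N)\<^sup>2) powr (- s / 2) * (C * (2 * pi * (1 + (real N)\<^sup>2) powr s)))
      \<longlonglongrightarrow> 0"
  proof -
    \<comment> \<open>The first factor grows like \<open>(2 * N) powr (- s)\<close> and the second
      decays like \<open>N powr (2 * s)\<close>, so the product behaves like a multiple of
      \<open>N powr s\<close>.\<close>
    have "(\<lambda>N. (1 + (2 * real N)\<^sup>2) powr (- s / 2) * (1 + (real N)\<^sup>2) powr s) \<longlonglongrightarrow> 0"
      using \<open>s < 0\<close> by real_asymp
    from tendsto_mult_right_zero[OF this, of "C * (2 * pi)"] show ?thesis
      by (simp add: mult_ac)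
  qed
  ultimately have "cmod (cis (- t) - 1) \<le> 0"
    using LIMSEQ_le by fastforce
  then have "sin t = 0"
    by (simp add: complex_eq_iff)
  moreover have "sin t > 0"
    using t pi_gt3 by (intro sin_gt_zero) auto
  ultimately show False by simp
qed

end
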